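(* For every ordered graph $F$, \begin{align*} \rho_{<}(F) &= \inf\Big\{\alpha\in[0,1] : \text{for all sufficiently large } d, \text{ every graph } G \text{ on } \{0,1\}^d \text{ with } \tfrac{1}{d}\textstyle\sum_{\ell=1}^d \frac{e_\ell(G)}{\tau_{\ell,d}}\ge\alpha \text{ contains } F\Big\}\\ &= \inf\{\alpha\in[0,1] : \text{there exists } C \text{ such that every } (\alpha,C)\text{-rich graph contains } F\}. \end{align*}
   Context: An ordered graph is a graph whose vertex set carries a total order. An ordered graph $G$ contains an ordered graph $F$ if there is an injective order-preserving map $V(F)\to V(G)$ sending edges of $F$ to edges of $G$; otherwise $G$ is $F$-free. For ordered graphs $F,G$ (with $e(G)>0$), $\rho_{<}(F,G)=\max\{e(G')/e(G): G'\subseteq G,\ G'\ F\text{-free}\}$ and $\rho_{<}(F)=\inf_G\rho_{<}(F,G)$ over all ordered graphs $G$. For distinct $x,y\in\{0,1\}^d$, $\delta(x,y)=\min\{i: x_i\ne y_i\}$; graphs on $\{0,1\}^d$ are ordered lexicographically ($x<y$ iff $x_{\delta(x,y)}=0$). For a graph $G$ on $\{0,1\}^d$, an edge $uv$ is a level-$\ell$ edge if $\delta(u,v)=\ell$, $e_\ell(G)$ is the number of level-$\ell$ edges, and $\tau_{\ell,d}=2^{2d-\ell-1}$ is the number of pairs $\{u,v\}$ with $\delta(u,v)=\ell$. A level $\ell\in[d]$ is $\alpha$-rich if $e_\ell(G)\ge\alpha\tau_{\ell,d}$; $G$ is $(\alpha,C)$-rich if at least $C$ levels are $\alpha$-rich.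 "Every $(\alpha,C)$-rich graph" ranges over all $d$ and all such graphs on $\{0,1\}^d$. *)

theory Defs
  imports Complex_Main
begin

text \<open>A (finite) ordered graph is given by a finite vertex set V, a strict total
order on V, and an edge set E of 2-element subsets of V.  Graphs F and G for the
Turan-density part live on natural numbers with the usual order (every finite
totally ordered set is order-isomorphic to a finite set of naturals).\<close>

definition is_graph :: "'a set \<Rightarrow> 'a set set \<Rightarrow> bool" where
  "is_graph V E \<longleftrightarrow> finite V \<and> E \<subseteq> {e. \<exists>u v. e = {u, v} \<and> u \<noteq> v \<and> u \<in> V \<and> v \<in> V}"

definition ord_contains ::
  "nat set \<Rightarrow> nat set set \<Rightarrow> 'a set \<Rightarrow> ('a \<Rightarrow> 'a \<Rightarrow> bool) \<Rightarrow> 'a set set \<Rightarrow> bool" where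
  "ord_contains VF EF VG lessG EG \<longleftrightarrow>
     (\<exists>f. f ` VF \<subseteq> VG \<and> inj_on f VF
        \<and> (\<forall>x\<in>VF. \<forall>y\<in>VF. x < y \<longrightarrow> lessG (f x) (f y))
        \<and> (\<forall>e\<in>EF. f ` e \<in> EG))"

text \<open>rho_<(F,G): maximum of e(G')/e(G) over F-free (spanning) subgraphs G' of G.
Convention: the maximum of the empty family is 0 (only relevant if F has no edges).\<close>

definition rho_FG :: "nat set \<Rightarrow> nat set set \<Rightarrow> nat set \<Rightarrow> nat set set \<Rightarrow> real" where
  "rho_FG VF EF VG EG =
     (let S = {real (card E') / real (card EG) | E'. E' \<subseteq> EG \<and> \<not> ord_contains VF EF VG (<) E'}
      in if S = {} then 0 else Max S)"

definition rho :: "nat set \<Rightarrow> nat set set \<Rightarrow> real" where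
  "rho VF EF = Inf {rho_FG VF EF VG EG | VG EG. is_graph VG EG \<and> card EG > 0}"

text \<open>Vertices of {0,1}^d are boolean lists of length d; x_i is x ! (i-1), with
False = 0 and True = 1.\<close>

definition cube :: "nat \<Rightarrow> bool list set" where
  "cube d = {x. length x = d}"

definition delta :: "bool list \<Rightarrow> bool list \<Rightarrow> nat" where
  "delta x y = (LEAST i. 1 \<le> i \<and> x ! (i - 1) \<noteq> y ! (i - 1))"

definition lex_less :: "bool list \<Rightarrow> bool list \<Rightarrow> bool" where
  "lex_less x y \<longleftrightarrow> x \<noteq> y \<and> \<not> x ! (delta x y - 1)"

definition level_edges :: "nat \<Rightarrow> bool list set set \<Rightarrow> nat" where
  "level_edges l E = card {e \<in> E. \<exists>u v. e = {u, v} \<and> u \<noteq> v \<and> delta u v = l}"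

definition tau :: "nat \<Rightarrow> nat \<Rightarrow> real" where
  "tau l d = 2 ^ (2 * d - l - 1)"

definition rich :: "real \<Rightarrow> nat \<Rightarrow> nat \<Rightarrow> bool list set set \<Rightarrow> bool" where
  "rich \<alpha> C d E \<longleftrightarrow> card {l \<in> {1..d}. real (level_edges l E) \<ge> \<alpha> * tau l d} \<ge> C"

end

theory Submission
  imports Defs "HOL-Library.FuncSet" "HOL-Library.Infinite_Set"
begin

text \<open>
  Write \<open>A\<close> and \<open>R\<close> for the thresholds given by average density and by richness. The proof is a
  cycle \<open>R \<le> \<rho> \<le> A \<le> R\<close>.

  \<open>R \<le> \<rho>\<close>: let \<open>\<rho>(F, G) < \<alpha>\<close> and let many levels of a cube graph be \<open>\<alpha>\<close>-rich. Embed \<open>G\<close> as a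
  random comb: a random spine \<open>x\<close> and, for the \<open>k\<close>-th vertex of \<open>G\<close>, a random point leaving the
  spine at level \<open>l\<^sub>k\<close>, where \<open>x\<close> has bit 1 at all chosen levels. Each edge of \<open>G\<close> then hits the cube
  graph with probability about \<open>\<alpha>\<close>, provided that fixing the bits at the chosen levels hardly changes
  the densities. By Bessel's inequality the density function of a level has few large Fourier
  coefficients, so the levels interfering with it are few, and a large independent set in the
  resulting digraph of bounded out-degree supplies the levels.

  \<open>\<rho> \<le> A\<close>: a blow-up of the complete graph on the cube in which all levels carry the same number of
  edges, and which is covered uniformly by copies of the cube, has no dense \<open>F\<close>-free subgraph.

  \<open>A \<le> R\<close>: level densities are at most 1, so an average above \<open>\<alpha>\<close> forces many \<open>\<alpha>\<close>-rich levels.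
\<close>

section \<open>Lexicographic order on the cube\<close>

text \<open>Positions count from 0 here and levels from 1, so for distinct points of the cube this
  amounts to \<open>delta x y = Suc i\<close>. It stands in for the \<open>LEAST\<close> hidden in
  \<open>delta\<close> and \<open>lex_less\<close>.\<close>

definition splits_at :: "nat \<Rightarrow> bool list \<Rightarrow> bool list \<Rightarrow> bool" where
  "splits_at i x y \<longleftrightarrow> (\<forall>j<i. x ! j = y ! j) \<and> x ! i \<noteq> y ! i"

lemma splits_at_sym: "splits_at i x y \<longleftrightarrow> splits_at i y x"
  by (auto simp: splits_at_def)

lemma splits_at_neq: "splits_at i x y \<Longrightarrow> x \<noteq> y"
  by (auto simp: splits_at_def)

lemma delta_eq_if_splits_at: "splits_at i x y \<Longrightarrow> delta x y = Suc i"
  unfolding delta_def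
proof (rule Least_equality)
  fix m assume s: "splits_at i x y" and m: "1 \<le> m \<and> x ! (m - 1) \<noteq> y ! (m - 1)"
  show "Suc i \<le> m"
  proof (rule ccontr)
    assume "\<not> Suc i \<le> m"
    then have "m - 1 < i" using m by linarith
    then show False using s m by (auto simp: splits_at_def)
  qed
qed (auto simp: splits_at_def)

lemma splits_at_exists:
  assumes "x \<in> cube d" "y \<in> cube d" "x \<noteq> y"
  obtains i where "i < d" "splits_at i x y"
proof -
  have "\<exists>i. i < d \<and> x ! i \<noteq> y ! i"
    using assms nth_equalityI[of x y] by (auto simp: cube_def)
  then obtain i where "i < d" "x ! i \<noteq> y ! i" "\<forall>j<i. \<not> (j < d \<and> x ! j \<noteq> y ! j)"
    using exists_least_iff[of "\<lambda>i. i < d \<and> x ! i \<noteq> y ! i"] by blast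
  then have "splits_at i x y" by (auto simp: splits_at_def)
  with \<open>i < d\<close> that show ?thesis by blast
qed

lemma delta_eq_Suc_iff:
  assumes "x \<in> cube d" "y \<in> cube d" "x \<noteq> y"
  shows "delta x y = Suc i \<longleftrightarrow> splits_at i x y"
proof -
  obtain j where j: "splits_at j x y" using splits_at_exists[OF assms] by blast
  then have "delta x y = Suc j" by (rule delta_eq_if_splits_at)
  then show ?thesis using j delta_eq_if_splits_at[of i x y] by auto
qed

lemma delta_sym: "delta x y = delta y x"
  unfolding delta_def by (rule arg_cong[where f = Least]) auto

lemma lex_less_iff_splits_at: "splits_at i x y \<Longrightarrow> lex_less x y \<longleftrightarrow> \<not> x ! i"
  by (auto simp: lex_less_def delta_eq_if_splits_at splits_at_neq)

lemma lex_less_total: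
  assumes "x \<in> cube d" "y \<in> cube d" "x \<noteq> y"
  shows "lex_less x y \<or> lex_less y x"
proof -
  obtain i where i: "splits_at i x y" using splits_at_exists[OF assms] by blast
  then have "splits_at i y x" by (simp only: splits_at_sym)
  moreover have "x ! i \<noteq> y ! i" using i by (simp add: splits_at_def)
  ultimately show ?thesis using i by (auto simp: lex_less_iff_splits_at)
qed

lemma finite_cube [simp]: "finite (cube d)"
  and card_cube: "card (cube d) = 2 ^ d"
proof -
  have "cube d = {xs. set xs \<subseteq> (UNIV :: bool set) \<and> length xs = d}"
    by (auto simp: cube_def)
  then show "finite (cube d)" "card (cube d) = 2 ^ d"
    using finite_lists_length_eq[of "UNIV :: bool set" d] card_lists_length_eq[of "UNIV :: bool set" d]
    by (auto simp: card_UNIV_bool)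
qed

lemma bij_betw_flip:
  assumes "i < d"
  shows "bij_betw (\<lambda>x. x[i := \<not> x ! i]) (cube d) (cube d)"
  by (rule bij_betw_byWitness[where f' = "\<lambda>x. x[i := \<not> x ! i]"]) (use assms in \<open>auto simp: cube_def\<close>)

section \<open>Characters of the cube\<close>

text \<open>\<open>True\<close> gets the sign +1 so that a function vanishing wherever bit
  \<open>i\<close> is 0 has equal coefficients at \<open>{}\<close> and \<open>{i}\<close>.\<close>

definition sgn_bit :: "bool \<Rightarrow> real" where
  "sgn_bit b = (if b then 1 else - 1)"

definition character :: "nat set \<Rightarrow> bool list \<Rightarrow> real" where
  "character S x = (\<Prod>i\<in>S. sgn_bit (x ! i))"

text \<open>The Walsh-Fourier coefficient with respect to the uniform measure on the cube.\<close>

definition coefficient :: "nat \<Rightarrow> (bool list \<Rightarrow> real) \<Rightarrow> nat set \<Rightarrow> real" where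
  "coefficient d g S = (\<Sum>x\<in>cube d. g x * character S x) / 2 ^ d"

lemma sgn_bit_simps [simp]:
  "sgn_bit True = 1" "sgn_bit False = - 1" "sgn_bit b * sgn_bit b = 1" "\<bar>sgn_bit b\<bar> = 1"
  "sgn_bit (\<not> b) = - sgn_bit b"
  by (auto simp: sgn_bit_def)

lemma character_square: "character S x * character S x = 1"
  by (simp add: character_def flip: prod.distrib)

lemma character_flip:
  assumes "finite S" "i < length x"
  shows "character S (x[i := \<not> x ! i]) = (if i \<in> S then - 1 else 1) * character S x"
proof -
  have eq: "(\<Prod>j\<in>S - {i}. sgn_bit (x[i := \<not> x ! i] ! j)) = (\<Prod>j\<in>S - {i}. sgn_bit (x ! j))"
    by (rule prod.cong) auto
  show ?thesis
  proof (cases "i \<in> S")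
    case True
    then show ?thesis
      using assms eq by (simp add: character_def prod.remove[of S i])
  next
    case False
    then show ?thesis using eq by (simp add: character_def)
  qed
qed

text \<open>Flipping a bit that lies in exactly one of \<open>S\<close> and \<open>T\<close>
  permutes the cube and negates the summand, so the sum equals its own negative.\<close>

lemma character_orthogonal:
  assumes "S \<subseteq> {..<d}" "T \<subseteq> {..<d}" "S \<noteq> T"
  shows "(\<Sum>x\<in>cube d. character S x * character T x) = 0"
proof -
  obtain i where i: "i \<in> S \<longleftrightarrow> i \<notin> T" "i < d" using assms by blast
  have fin: "finite S" "finite T" using assms finite_subset by blast+
  let ?h = "\<lambda>x. character S x * character T x"
  have "(\<Sum>x\<in>cube d. ?h x) = (\<Sum>x\<in>cube d. ?h (x[i := \<not> x ! i]))"
    by (rule sum.reindex_bij_betw[OF bij_betw_flip[OF i(2)], symmetric])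
  also have "\<dots> = (\<Sum>x\<in>cube d. - ?h x)"
    by (rule sum.cong) (use i fin in \<open>auto simp: character_flip cube_def\<close>)
  finally show ?thesis by (simp add: sum_negf)
qed

text \<open>The mean square of \<open>g\<close> minus its projection onto the characters in
  \<open>B\<close> is nonnegative. It equals the mean square of \<open>g\<close>, at most 1, minus
  the sum of the squared coefficients.\<close>

lemma bessel:
  assumes B: "B \<subseteq> Pow {..<d}" and g: "\<And>x. x \<in> cube d \<Longrightarrow> \<bar>g x\<bar> \<le> 1"
  shows "(\<Sum>S\<in>B. (coefficient d g S)\<^sup>2) \<le> 1"
proof -
  let ?c = "coefficient d g"
  let ?p = "\<lambda>x. \<Sum>S\<in>B. ?c S * character S x"
  have fin: "finite B" using B finite_subset by blast
  have c: "(\<Sum>x\<in>cube d. g x * character S x) = 2 ^ d * ?c S" for S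
    by (simp add: coefficient_def)
  have gp: "(\<Sum>x\<in>cube d. g x * ?p x) = 2 ^ d * (\<Sum>S\<in>B. (?c S)\<^sup>2)"
  proof -
    have "(\<Sum>x\<in>cube d. g x * ?p x) = (\<Sum>S\<in>B. \<Sum>x\<in>cube d. ?c S * (g x * character S x))"
      unfolding sum_distrib_left by (subst sum.swap) (simp add: mult_ac)
    also have "\<dots> = (\<Sum>S\<in>B. ?c S * (2 ^ d * ?c S))"
      by (simp add: c flip: sum_distrib_left)
    finally show ?thesis by (simp add: sum_distrib_left power2_eq_square mult_ac)
  qed
  have orth: "(\<Sum>x\<in>cube d. character S x * character T x) = (if T = S then 2 ^ d else 0)"
    if "S \<in> B" "T \<in> B" for S T
    using that B character_orthogonal[of S d T] by (auto simp: character_square card_cube)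
  have pp: "(\<Sum>x\<in>cube d. ?p x * ?p x) = 2 ^ d * (\<Sum>S\<in>B. (?c S)\<^sup>2)"
  proof -
    have "(\<Sum>x\<in>cube d. ?p x * ?p x)
        = (\<Sum>x\<in>cube d. \<Sum>S\<in>B. \<Sum>T\<in>B. ?c S * ?c T * (character S x * character T x))"
      by (simp add: sum_product mult_ac)
    also have "\<dots> = (\<Sum>S\<in>B. \<Sum>x\<in>cube d. \<Sum>T\<in>B. ?c S * ?c T * (character S x * character T x))"
      by (rule sum.swap)
    also have "\<dots> = (\<Sum>S\<in>B. \<Sum>T\<in>B. \<Sum>x\<in>cube d. ?c S * ?c T * (character S x * character T x))"
      by (rule sum.cong[OF refl]) (rule sum.swap)
    also have "\<dots> = (\<Sum>S\<in>B. \<Sum>T\<in>B. ?c S * ?c T * (if T = S then 2 ^ d else 0))"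
      by (intro sum.cong refl) (simp add: orth flip: sum_distrib_left)
    also have "\<dots> = (\<Sum>S\<in>B. \<Sum>T\<in>B. if T = S then ?c S * ?c T * 2 ^ d else 0)"
      by (intro sum.cong refl) auto
    also have "\<dots> = (\<Sum>S\<in>B. ?c S * ?c S * 2 ^ d)"
      using fin by (simp add: sum.delta')
    finally show ?thesis by (simp add: sum_distrib_left power2_eq_square mult_ac)
  qed
  have "0 \<le> (\<Sum>x\<in>cube d. (g x - ?p x)\<^sup>2)" by (simp add: sum_nonneg)
  also have "\<dots> = (\<Sum>x\<in>cube d. (g x)\<^sup>2 - 2 * (g x * ?p x) + ?p x * ?p x)"
    by (rule sum.cong) (auto simp: power2_eq_square algebra_simps)
  also have "\<dots> = (\<Sum>x\<in>cube d. (g x)\<^sup>2) - 2 * (\<Sum>x\<in>cube d. g x * ?p x) + (\<Sum>x\<in>cube d. ?p x * ?p x)"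
    by (simp only: sum.distrib sum_subtractf sum_distrib_left)
  also have "\<dots> = (\<Sum>x\<in>cube d. (g x)\<^sup>2) - 2 ^ d * (\<Sum>S\<in>B. (?c S)\<^sup>2)"
    unfolding gp pp by simp
  also have "\<dots> \<le> 2 ^ d - 2 ^ d * (\<Sum>S\<in>B. (?c S)\<^sup>2)"
  proof -
    have "(\<Sum>x\<in>cube d. (g x)\<^sup>2) \<le> (\<Sum>x\<in>cube d. 1)"
      by (rule sum_mono) (use g abs_square_le_1 in blast)
    then show ?thesis by (simp add: card_cube)
  qed
  finally have "2 ^ d * (\<Sum>S\<in>B. (?c S)\<^sup>2) \<le> 2 ^ d * 1" by simp
  then show ?thesis by (simp only: mult_le_cancel_left_pos zero_less_power zero_less_numeral)
qed

text \<open>Each large coefficient uses up more than \<open>\<epsilon>\<^sup>2\<close> of the total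
  1 in Bessel's inequality. The bound is independent of \<open>d\<close>, which later allows a
  number \<open>C\<close> of levels that is independent of \<open>d\<close>.\<close>

lemma card_large_coefficients:
  assumes "\<epsilon> > 0" and g: "\<And>x. x \<in> cube d \<Longrightarrow> \<bar>g x\<bar> \<le> 1"
  shows "real (card {S \<in> Pow {..<d}. \<bar>coefficient d g S\<bar> > \<epsilon>}) \<le> 1 / \<epsilon>\<^sup>2"
proof -
  let ?B = "{S \<in> Pow {..<d}. \<bar>coefficient d g S\<bar> > \<epsilon>}"
  have "real (card ?B) * \<epsilon>\<^sup>2 = (\<Sum>S\<in>?B. \<epsilon>\<^sup>2)" by simp
  also have "\<dots> \<le> (\<Sum>S\<in>?B. (coefficient d g S)\<^sup>2)"
  proof (rule sum_mono)
    fix S assume "S \<in> ?B"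
    then have "\<bar>\<epsilon>\<bar> \<le> \<bar>coefficient d g S\<bar>" using \<open>\<epsilon> > 0\<close> by auto
    then show "\<epsilon>\<^sup>2 \<le> (coefficient d g S)\<^sup>2" by (simp only: abs_le_square_iff)
  qed
  also have "\<dots> \<le> 1" using bessel[of ?B d g] g by auto
  finally show ?thesis using \<open>\<epsilon> > 0\<close> by (simp add: field_simps)
qed

section \<open>Restriction to subcubes\<close>

definition subcube :: "nat \<Rightarrow> nat set \<Rightarrow> (nat \<Rightarrow> bool) \<Rightarrow> bool list set" where
  "subcube d T b = {x \<in> cube d. \<forall>i\<in>T. x ! i = b i}"

text \<open>The indicator of a subcube is a product of factors (1 + s t) / 2, with s and t the signs
  of \<open>b i\<close> and \<open>x ! i\<close>. Multiplying out gives one character for each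
  subset of \<open>T\<close>.\<close>

lemma sum_subcube:
  assumes "finite T"
  shows "(\<Sum>x\<in>subcube d T b. g x)
       = 2 ^ d / 2 ^ card T * (\<Sum>S\<in>Pow T. (\<Prod>i\<in>S. sgn_bit (b i)) * coefficient d g S)"
proof -
  have ind: "(if x \<in> subcube d T b then 1 else 0)
      = (\<Sum>S\<in>Pow T. (\<Prod>i\<in>S. sgn_bit (b i)) * character S x) / 2 ^ card T"
    if "x \<in> cube d" for x
  proof -
    have "(if x \<in> subcube d T b then 1 else 0) = (\<Prod>i\<in>T. if x ! i = b i then 1 else (0::real))"
      using assms that by (auto simp: subcube_def intro: prod.neutral)
    also have "\<dots> = (\<Prod>i\<in>T. (sgn_bit (b i) * sgn_bit (x ! i) + 1) / 2)"
      by (rule prod.cong) (auto simp: sgn_bit_def)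
    also have "\<dots> = (\<Prod>i\<in>T. sgn_bit (b i) * sgn_bit (x ! i) + 1) / 2 ^ card T"
      by (simp add: prod_dividef)
    also have "(\<Prod>i\<in>T. sgn_bit (b i) * sgn_bit (x ! i) + 1)
        = (\<Sum>S\<in>Pow T. (\<Prod>i\<in>S. sgn_bit (b i)) * character S x)"
      using assms by (simp add: prod_add character_def prod.distrib)
    finally show ?thesis .
  qed
  have "(\<Sum>x\<in>subcube d T b. g x) = (\<Sum>x\<in>cube d. g x * (if x \<in> subcube d T b then 1 else 0))"
    by (rule sum.mono_neutral_cong_left) (auto simp: subcube_def)
  also have "\<dots> = (\<Sum>x\<in>cube d. \<Sum>S\<in>Pow T. (\<Prod>i\<in>S. sgn_bit (b i)) * (g x * character S x) / 2 ^ card T)"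
    by (rule sum.cong) (simp_all add: ind sum_distrib_left sum_divide_distrib mult_ac)
  also have "\<dots> = (\<Sum>S\<in>Pow T. \<Sum>x\<in>cube d. (\<Prod>i\<in>S. sgn_bit (b i)) * (g x * character S x) / 2 ^ card T)"
    by (rule sum.swap)
  also have "\<dots> = (\<Sum>S\<in>Pow T. (\<Prod>i\<in>S. sgn_bit (b i)) * (2 ^ d * coefficient d g S) / 2 ^ card T)"
    by (simp add: coefficient_def flip: sum_distrib_left sum_divide_distrib)
  finally show ?thesis by (simp add: sum_distrib_left mult_ac)
qed

lemma card_subcube:
  assumes "T \<subseteq> {..<d}"
  shows "real (card (subcube d T b)) = 2 ^ d / 2 ^ card T"
proof -
  have fin: "finite T" using assms finite_subset by blast
  have co: "coefficient d (\<lambda>_. 1) S = (if S = {} then 1 else 0)" if "S \<in> Pow T" for S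
    using that assms character_orthogonal[of S d "{}"]
    by (auto simp: coefficient_def character_def card_cube)
  have "real (card (subcube d T b)) = (\<Sum>x\<in>subcube d T b. 1)" by simp
  also have "\<dots> = 2 ^ d / 2 ^ card T * (\<Sum>S\<in>Pow T. if S = {} then 1 else 0)"
    unfolding sum_subcube[OF fin] by (intro arg_cong2[where f = "(*)"] refl sum.cong) (auto simp: co)
  finally show ?thesis using fin by (simp add: sum.delta')
qed

section \<open>Levels\<close>

definition nbrs :: "bool list set set \<Rightarrow> nat \<Rightarrow> nat \<Rightarrow> bool list \<Rightarrow> bool list set" where
  "nbrs E d i y = {z \<in> cube d. splits_at i z y \<and> {z, y} \<in> E}"

lemma is_graph_edge_subset:
  assumes "is_graph V E" "e \<in> E"
  shows "e \<subseteq> V"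
proof -
  have "E \<subseteq> {e. \<exists>u v. e = {u, v} \<and> u \<noteq> v \<and> u \<in> V \<and> v \<in> V}"
    using assms(1) by (simp only: is_graph_def)
  from subsetD[OF this assms(2)] show ?thesis by auto
qed

lemma finite_edges:
  assumes "is_graph V E"
  shows "finite E"
proof (rule finite_subset)
  show "E \<subseteq> Pow V" using is_graph_edge_subset[OF assms] by blast
  show "finite (Pow V)" using assms by (simp add: is_graph_def)
qed

text \<open>Such a point copies the first \<open>i\<close> bits of \<open>y\<close>, reverses bit
  \<open>i\<close> and is free in the remaining \<open>d - 1 - i\<close> places.\<close>

lemma card_splits_at:
  assumes "i < d" "y \<in> cube d"
  shows "card {z \<in> cube d. splits_at i z y} = 2 ^ (d - 1 - i)"
proof -
  let ?f = "\<lambda>t. take i y @ (\<not> y ! i) # t"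
  have len: "length y = d" using assms by (simp add: cube_def)
  have "{z \<in> cube d. splits_at i z y} = ?f ` cube (d - 1 - i)"
  proof (intro subset_antisym subsetI)
    fix z assume "z \<in> {z \<in> cube d. splits_at i z y}"
    then have z: "length z = d" "\<forall>j<i. z ! j = y ! j" "z ! i = (\<not> y ! i)"
      by (auto simp: cube_def splits_at_def)
    have "take i z = take i y" using z len by (intro nth_equalityI) auto
    then have "z = ?f (drop (Suc i) z)"
      using id_take_nth_drop[of i z] z assms(1) by auto
    then show "z \<in> ?f ` cube (d - 1 - i)" using z by (auto simp: cube_def)
  next
    fix z assume "z \<in> ?f ` cube (d - 1 - i)"
    then show "z \<in> {z \<in> cube d. splits_at i z y}"
      using len assms(1) by (auto simp: cube_def splits_at_def nth_append)
  qed
  moreover have "inj_on ?f (cube (d - 1 - i))" by (auto simp: inj_on_def)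
  ultimately show ?thesis by (simp add: card_image card_cube)
qed

lemma finite_nbrs [simp]: "finite (nbrs E d i y)"
  by (simp add: nbrs_def)

lemma card_nbrs_le:
  assumes "i < d" "y \<in> cube d"
  shows "card (nbrs E d i y) \<le> 2 ^ (d - 1 - i)"
  unfolding card_splits_at[OF assms, symmetric] nbrs_def by (rule card_mono) auto

text \<open>Each edge is charged to its lexicographically larger end, the one with bit
  \<open>i\<close> set. The ends differ at \<open>i\<close>, so this end is unique.\<close>

lemma level_edges_eq_sum:
  assumes "is_graph (cube d) E" "i < d"
  shows "level_edges (Suc i) E = (\<Sum>y\<in>subcube d {i} (\<lambda>_. True). card (nbrs E d i y))"
proof -
  let ?Q = "subcube d {i} (\<lambda>_. True)"
  let ?L = "{e \<in> E. \<exists>u v. e = {u, v} \<and> u \<noteq> v \<and> delta u v = Suc i}"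
  have "bij_betw (\<lambda>(y, z). {z, y}) (Sigma ?Q (nbrs E d i)) ?L"
  proof (rule bij_betw_imageI)
    show "inj_on (\<lambda>(y, z). {z, y}) (Sigma ?Q (nbrs E d i))"
    proof (rule inj_onI, clarify)
      fix y z y' z'
      assume "y \<in> ?Q" "z \<in> nbrs E d i y" "y' \<in> ?Q" "z' \<in> nbrs E d i y'" and eq: "{z, y} = {z', y'}"
      then have "y ! i" "\<not> z ! i" "y' ! i" "\<not> z' ! i"
        by (simp_all add: subcube_def nbrs_def splits_at_def)
      then show "y = y' \<and> z = z'" using eq unfolding doubleton_eq_iff by auto
    qed
    show "(\<lambda>(y, z). {z, y}) ` Sigma ?Q (nbrs E d i) = ?L"
    proof (intro subset_antisym subsetI)
      fix e assume "e \<in> (\<lambda>(y, z). {z, y}) ` Sigma ?Q (nbrs E d i)"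
      then obtain y z where yz: "e = {z, y}" "z \<in> nbrs E d i y" by auto
      then have "e \<in> E" "z \<noteq> y" "delta z y = Suc i"
        by (auto simp: nbrs_def delta_eq_if_splits_at dest: splits_at_neq)
      with yz(1) show "e \<in> ?L" by blast
    next
      fix e assume e: "e \<in> ?L"
      then obtain u v where uv: "e = {u, v}" "u \<noteq> v" "delta u v = Suc i" by blast
      have eE: "{u, v} \<in> E" using e uv(1) by simp
      have "e \<subseteq> cube d" using e by (intro is_graph_edge_subset[OF assms(1)]) simp
      then have mem: "u \<in> cube d" "v \<in> cube d" using uv by auto
      have s: "splits_at i u v" using delta_eq_Suc_iff mem uv by blast
      show "e \<in> (\<lambda>(y, z). {z, y}) ` Sigma ?Q (nbrs E d i)"
      proof (cases "v ! i")
        case True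
        then have "(v, u) \<in> Sigma ?Q (nbrs E d i)"
          using mem s eE by (simp add: subcube_def nbrs_def)
        moreover have "e = (\<lambda>(y, z). {z, y}) (v, u)" using uv by simp
        ultimately show ?thesis by (rule rev_image_eqI)
      next
        case False
        then have "(u, v) \<in> Sigma ?Q (nbrs E d i)"
          using mem s eE by (simp add: subcube_def nbrs_def splits_at_def insert_commute)
        moreover have "e = (\<lambda>(y, z). {z, y}) (u, v)" using uv by auto
        ultimately show ?thesis by (rule rev_image_eqI)
      qed
    qed
  qed
  then have "level_edges (Suc i) E = card (Sigma ?Q (nbrs E d i))"
    unfolding level_edges_def by (simp add: bij_betw_same_card)
  also have "\<dots> = (\<Sum>y\<in>?Q. card (nbrs E d i y))"
    by (rule card_SigmaI) (auto simp: subcube_def)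
  finally show ?thesis .
qed

text \<open>Reads \<open>tau\<close> as the number of upper ends times the number of possible
  partners of each, the form that matches \<open>level_edges_eq_sum\<close>.\<close>

lemma tau_Suc: "i < d \<Longrightarrow> tau (Suc i) d = real (card (subcube d {i} (\<lambda>_. True))) * 2 ^ (d - 1 - i)"
proof -
  assume "i < d"
  then have "2 * d - Suc i - 1 = (d - 1) + (d - 1 - i)" "d = Suc (d - 1)" by auto
  then have "tau (Suc i) d = 2 ^ (d - 1) * 2 ^ (d - 1 - i)"
    by (simp add: tau_def flip: power_add)
  moreover have "(2::real) ^ d / 2 = 2 ^ (d - 1)"
    by (subst \<open>d = Suc (d - 1)\<close>) simp
  ultimately show ?thesis using card_subcube[of "{i}" d] \<open>i < d\<close> by simp
qed

lemma tau_pos: "tau l d > 0"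
  by (simp add: tau_def)

lemma level_edges_le_tau:
  assumes "is_graph (cube d) E" "l \<in> {1..d}"
  shows "real (level_edges l E) \<le> tau l d"
proof -
  obtain i where i: "l = Suc i" "i < d" using assms(2) by (cases l) auto
  have "real (level_edges l E) = (\<Sum>y\<in>subcube d {i} (\<lambda>_. True). real (card (nbrs E d i y)))"
    using i level_edges_eq_sum[OF assms(1)] by simp
  also have "\<dots> \<le> (\<Sum>y\<in>subcube d {i} (\<lambda>_. True). 2 ^ (d - 1 - i))"
  proof (rule sum_mono)
    fix y assume "y \<in> subcube d {i} (\<lambda>_. True)"
    then show "real (card (nbrs E d i y)) \<le> 2 ^ (d - 1 - i)"
      using card_nbrs_le[OF i(2), of y E] by (auto simp: subcube_def simp flip: of_nat_le_iff)
  qed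
  also have "\<dots> = tau l d" using i by (simp add: tau_Suc)
  finally show ?thesis .
qed

section \<open>Random combs\<close>

lemma sum_indicator_eq_card:
  "finite A \<Longrightarrow> (\<Sum>x\<in>A. if P x then 1 else (0 :: 'a :: semiring_1)) = of_nat (card {x \<in> A. P x})"
  by (simp flip: sum.inter_filter)

text \<open>Out-degrees are at most \<open>D\<close>, so the average in-degree is too, and some
  vertex has in-degree at most \<open>D\<close>. Keep it, delete it with its in- and out-neighbours,
  at most \<open>2 * D + 1\<close> vertices in all, and induct on \<open>n\<close>.\<close>

lemma sparse_digraph_independent_set:
  fixes A :: "'a \<Rightarrow> 'a set"
  assumes "finite L" "\<And>l. l \<in> L \<Longrightarrow> finite (A l) \<and> card (A l) \<le> D"
    and "card L \<ge> n * (2 * D + 1)"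
  shows "\<exists>N\<subseteq>L. card N = n \<and> (\<forall>l\<in>N. \<forall>m\<in>N. m \<noteq> l \<longrightarrow> m \<notin> A l)"
  using assms
proof (induction n arbitrary: L)
  case 0
  then show ?case by (intro exI[of _ "{}"]) auto
next
  case (Suc n)
  have "\<exists>v\<in>L. card {l \<in> L. v \<in> A l} \<le> D"
  proof (rule ccontr)
    assume "\<not> ?thesis"
    then have big: "Suc D \<le> card {l \<in> L. v \<in> A l}" if "v \<in> L" for v using that by force
    have "card L * Suc D \<le> (\<Sum>v\<in>L. card {l \<in> L. v \<in> A l})"
      using sum_mono[of L "\<lambda>_. Suc D" "\<lambda>v. card {l \<in> L. v \<in> A l}"] big by simp
    also have "\<dots> = (\<Sum>v\<in>L. \<Sum>l\<in>L. if v \<in> A l then 1 else 0)"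
      using Suc.prems(1) by (simp add: sum_indicator_eq_card)
    also have "\<dots> = (\<Sum>l\<in>L. \<Sum>v\<in>L. if v \<in> A l then 1 else 0)" by (rule sum.swap)
    also have "\<dots> = (\<Sum>l\<in>L. card {v \<in> L. v \<in> A l})"
      using Suc.prems(1) by (simp add: sum_indicator_eq_card)
    also have "\<dots> \<le> (\<Sum>l\<in>L. D)"
    proof (rule sum_mono)
      fix l assume l: "l \<in> L"
      have "card {v \<in> L. v \<in> A l} \<le> card (A l)"
        using Suc.prems(2)[OF l] by (intro card_mono) auto
      then show "card {v \<in> L. v \<in> A l} \<le> D" using Suc.prems(2)[OF l] by simp
    qed
    finally have "card L = 0" by simp
    then show False using Suc.prems(3) by simp
  qed
  then obtain v where v: "v \<in> L" "card {l \<in> L. v \<in> A l} \<le> D" by blast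
  define X where "X = insert v ({l \<in> L. v \<in> A l} \<union> A v)"
  have finX: "finite X" using Suc.prems(1,2) v(1) by (auto simp: X_def)
  have "card X \<le> Suc (card ({l \<in> L. v \<in> A l} \<union> A v))"
    unfolding X_def by (rule card_insert_le_m1) auto
  also have "card ({l \<in> L. v \<in> A l} \<union> A v) \<le> card {l \<in> L. v \<in> A l} + card (A v)"
    by (rule card_Un_le)
  also have "\<dots> \<le> D + D" using v Suc.prems(2) by (intro add_mono) auto
  finally have "card X \<le> 2 * D + 1" by simp
  then have "n * (2 * D + 1) \<le> card (L - X)"
    using diff_card_le_card_Diff[OF finX, of L] Suc.prems(3) by simp
  then obtain N where N: "N \<subseteq> L - X" "card N = n" "\<forall>l\<in>N. \<forall>m\<in>N. m \<noteq> l \<longrightarrow> m \<notin> A l"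
    using Suc.IH[of "L - X"] Suc.prems(1,2) by auto
  have "finite N" using N(1) Suc.prems(1) finite_subset by blast
  moreover have "v \<notin> N" using N(1) by (auto simp: X_def)
  ultimately show ?case
    using N v(1) by (intro exI[of _ "insert v N"]) (auto simp: X_def)
qed

text \<open>A tooth of the comb: \<open>x\<close> before position \<open>i\<close>, the opposite bit
  at \<open>i\<close>, and \<open>x\<close> XOR \<open>r\<close> afterwards. Being an XOR, the map
  is an involution in \<open>x\<close>, so a uniform spine gives a uniform tooth.\<close>

definition branch :: "nat \<Rightarrow> bool list \<Rightarrow> bool list \<Rightarrow> bool list" where
  "branch i r x = map (\<lambda>j. x ! j \<noteq> (j = i \<or> i < j \<and> r ! j)) [0..<length x]"

lemma branch_in_cube [simp]: "branch i r x \<in> cube d \<longleftrightarrow> x \<in> cube d"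
  by (simp add: branch_def cube_def)

lemma nth_branch: "x \<in> cube d \<Longrightarrow> j < d \<Longrightarrow> branch i r x ! j = (x ! j \<noteq> (j = i \<or> i < j \<and> r ! j))"
  by (simp add: branch_def cube_def)

lemma branch_branch [simp]: "branch i r (branch i r x) = x"
  by (rule nth_equalityI) (auto simp: branch_def)

lemma sum_subcube_branch:
  assumes "T \<subseteq> {..<d}"
  shows "(\<Sum>x\<in>subcube d T b. g (branch i r x))
       = (\<Sum>y\<in>subcube d T (\<lambda>j. b j \<noteq> (j = i \<or> i < j \<and> r ! j)). g y)"
  by (rule sum.reindex_bij_witness[of _ "branch i r" "branch i r"])
    (use assms in \<open>auto simp: subcube_def nth_branch subset_iff\<close>)

text \<open>Each neighbour \<open>z\<close> arises from \<open>2 ^ Suc i\<close> seeds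
  \<open>r\<close>: the first \<open>i + 1\<close> bits of \<open>r\<close> are free, and the later
  ones are the XOR of \<open>z\<close> and \<open>x\<close>.\<close>

lemma card_branch_edges_ge:
  assumes x: "x \<in> cube d" and y: "y \<in> cube d" and i: "i < d" and agree: "\<And>j. j \<le> i \<Longrightarrow> x ! j = y ! j"
  shows "2 ^ Suc i * card (nbrs E d i y) \<le> card {r \<in> cube d. {branch i r x, y} \<in> E}"
proof -
  define f where "f = (\<lambda>(u, z). u @ map (\<lambda>j. z ! j \<noteq> x ! j) [Suc i..<d])"
  have len: "f (u, z) \<in> cube d" if "u \<in> cube (Suc i)" for u z
    using that i by (simp add: f_def cube_def)
  have br: "branch i (f (u, z)) x = z" if u: "u \<in> cube (Suc i)" and z: "z \<in> nbrs E d i y" for u z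
  proof (rule nth_equalityI)
    show "length (branch i (f (u, z)) x) = length z"
      using x z by (simp add: nbrs_def cube_def branch_def)
    fix j assume "j < length (branch i (f (u, z)) x)"
    then have j: "j < d" using x by (simp add: branch_def cube_def)
    consider "j < i" | "j = i" | "i < j" by linarith
    then show "branch i (f (u, z)) x ! j = z ! j"
    proof cases
      case 1
      then show ?thesis using z agree[of j] x j by (auto simp: nth_branch nbrs_def splits_at_def)
    next
      case 2
      then show ?thesis using z agree[of j] x j by (auto simp: nth_branch nbrs_def splits_at_def)
    next
      case 3
      then have "f (u, z) ! j = (z ! j \<noteq> x ! j)"
        using u j nth_upt[of "Suc i" "j - Suc i" d] by (simp add: f_def nth_append cube_def del: upt_Suc)
      then show ?thesis using x j 3 by (auto simp: nth_branch)
    qed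
  qed
  have "inj_on f (cube (Suc i) \<times> nbrs E d i y)"
  proof (rule inj_onI, clarify)
    fix u z u' z'
    assume u: "u \<in> cube (Suc i)" "u' \<in> cube (Suc i)" and z: "z \<in> nbrs E d i y" "z' \<in> nbrs E d i y"
      and eq: "f (u, z) = f (u', z')"
    have "z = z'" using br u z eq by metis
    moreover have "u = u'" using u eq by (simp add: f_def cube_def)
    ultimately show "u = u' \<and> z = z'" by simp
  qed
  moreover have "f ` (cube (Suc i) \<times> nbrs E d i y) \<subseteq> {r \<in> cube d. {branch i r x, y} \<in> E}"
  proof clarify
    fix u z assume "u \<in> cube (Suc i)" "z \<in> nbrs E d i y"
    then show "f (u, z) \<in> cube d \<and> {branch i (f (u, z)) x, y} \<in> E"
      using len br by (simp add: nbrs_def)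
  qed
  ultimately have "card (cube (Suc i) \<times> nbrs E d i y) \<le> card {r \<in> cube d. {branch i r x, y} \<in> E}"
    by (intro card_inj_on_le) auto
  then show ?thesis by (simp add: card_cartesian_product card_cube)
qed

text \<open>The chance that a random point splitting from \<open>y\<close> at \<open>i\<close> is
  adjacent to \<open>y\<close>. It is cut to 0 unless bit \<open>i\<close> is set, because
  \<open>y\<close> is meant to be the upper end of the edge.\<close>

definition up_density :: "bool list set set \<Rightarrow> nat \<Rightarrow> nat \<Rightarrow> bool list \<Rightarrow> real" where
  "up_density E d i y = (if y ! i then real (card (nbrs E d i y)) / 2 ^ (d - 1 - i) else 0)"

lemma abs_up_density_le: "i < d \<Longrightarrow> y \<in> cube d \<Longrightarrow> \<bar>up_density E d i y\<bar> \<le> 1"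
  using card_nbrs_le[of i d y E] by (simp add: up_density_def flip: of_nat_le_iff)

text \<open>Bit \<open>i\<close> is set on the support of the density, so both characters equal 1
  there. Each of the two coefficients is half of the level density.\<close>

lemma coefficient_up_density:
  assumes "is_graph (cube d) E" "i < d" "S \<subseteq> {i}"
  shows "coefficient d (up_density E d i) S = real (level_edges (Suc i) E) / (2 * tau (Suc i) d)"
proof -
  have "(\<Sum>x\<in>cube d. up_density E d i x * character S x)
      = (\<Sum>x\<in>subcube d {i} (\<lambda>_. True). real (card (nbrs E d i x)) / 2 ^ (d - 1 - i))"
    using assms(3)
    by (intro sum.mono_neutral_cong_right)
      (auto simp: subcube_def up_density_def character_def dest: subset_singletonD)
  also have "\<dots> = real (level_edges (Suc i) E) / 2 ^ (d - 1 - i)"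
    by (simp add: level_edges_eq_sum[OF assms(1,2)] flip: sum_divide_distrib)
  finally show ?thesis
    using assms(2) card_subcube[of "{i}" d "\<lambda>_. True"] by (simp add: coefficient_def tau_Suc)
qed

text \<open>The Fourier terms at \<open>{}\<close> and \<open>{i}\<close> add up to the level
  density, and every other subset of \<open>T\<close> costs at most \<open>\<epsilon>\<close>. So
  prescribing the bits in \<open>T\<close>, with bit \<open>i\<close> set, hardly lowers the
  density.\<close>

lemma sum_up_density_subcube_ge:
  assumes E: "is_graph (cube d) E" and T: "T \<subseteq> {..<d}" "i \<in> T" and b: "b i"
    and dense: "real (level_edges (Suc i) E) \<ge> \<alpha> * tau (Suc i) d"
    and small: "\<And>S. S \<subseteq> T \<Longrightarrow> S - {i} \<noteq> {} \<Longrightarrow> \<bar>coefficient d (up_density E d i) S\<bar> \<le> \<epsilon>"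
    and "\<epsilon> \<ge> 0"
  shows "(\<Sum>y\<in>subcube d T b. up_density E d i y) \<ge> (\<alpha> - 2 ^ card T * \<epsilon>) * real (card (subcube d T b))"
proof -
  have fin: "finite T" using T finite_subset by blast
  let ?c = "\<lambda>S. (\<Prod>j\<in>S. sgn_bit (b j)) * coefficient d (up_density E d i) S"
  let ?M = "{{}, {i}}"
  have "i < d" using T by auto
  have M: "?c S = real (level_edges (Suc i) E) / (2 * tau (Suc i) d)" if "S \<in> ?M" for S
    using that b coefficient_up_density[OF E \<open>i < d\<close>] by auto
  have "(\<Sum>S\<in>?M. ?c S) = (\<Sum>S\<in>?M. real (level_edges (Suc i) E) / (2 * tau (Suc i) d))"
    by (rule sum.cong[OF refl M])
  also have "\<dots> = real (level_edges (Suc i) E) / tau (Suc i) d" by simp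
  also have "\<dots> \<ge> \<alpha>" using dense tau_pos[of "Suc i" d] by (simp add: field_simps)
  finally have main: "(\<Sum>S\<in>?M. ?c S) \<ge> \<alpha>" .
  have "\<bar>\<Sum>S\<in>Pow T - ?M. ?c S\<bar> \<le> (\<Sum>S\<in>Pow T - ?M. \<epsilon>)"
  proof (rule order_trans[OF sum_abs sum_mono])
    fix S assume "S \<in> Pow T - ?M"
    then have "\<bar>coefficient d (up_density E d i) S\<bar> \<le> \<epsilon>" by (intro small) auto
    then show "\<bar>?c S\<bar> \<le> \<epsilon>" by (simp add: abs_mult abs_prod)
  qed
  also have "\<dots> \<le> real (card (Pow T)) * \<epsilon>"
    unfolding sum_constant
    using fin \<open>\<epsilon> \<ge> 0\<close> by (intro mult_right_mono of_nat_mono card_mono) auto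
  finally have err: "\<bar>\<Sum>S\<in>Pow T - ?M. ?c S\<bar> \<le> 2 ^ card T * \<epsilon>" by (simp add: card_Pow fin)
  have "(\<Sum>S\<in>Pow T. ?c S) = (\<Sum>S\<in>Pow T - ?M. ?c S) + (\<Sum>S\<in>?M. ?c S)"
    using fin T by (intro sum.subset_diff) auto
  then have "\<alpha> - 2 ^ card T * \<epsilon> \<le> (\<Sum>S\<in>Pow T. ?c S)" using main err by linarith
  then have "2 ^ d / 2 ^ card T * (\<alpha> - 2 ^ card T * \<epsilon>) \<le> 2 ^ d / 2 ^ card T * (\<Sum>S\<in>Pow T. ?c S)"
    by (intro mult_left_mono) auto
  then show ?thesis
    unfolding sum_subcube[OF fin] card_subcube[OF T(1)] by (simp only: mult.commute)
qed

text \<open>Exchanging the fresh value \<open>a\<close> with the entry \<open>r j\<close> is an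
  involution on the pairs \<open>(r, a)\<close>: resampling one coordinate preserves the uniform
  distribution.\<close>

lemma sum_PiE_resample:
  fixes F :: "('a \<Rightarrow> 'b) \<Rightarrow> real"
  assumes "j \<in> I"
  shows "(\<Sum>r\<in>PiE I (\<lambda>_. B). \<Sum>a\<in>B. F (r(j := a))) = real (card B) * (\<Sum>r\<in>PiE I (\<lambda>_. B). F r)"
proof -
  let ?R = "PiE I (\<lambda>_. B)"
  have "(\<Sum>r\<in>?R. \<Sum>a\<in>B. F (r(j := a))) = (\<Sum>(r, a)\<in>?R \<times> B. F (r(j := a)))"
    by (rule sum.cartesian_product)
  also have "\<dots> = (\<Sum>(r, a)\<in>?R \<times> B. F r)"
    by (rule sum.reindex_bij_witness[of _ "\<lambda>(r, a). (r(j := a), r j)" "\<lambda>(r, a). (r(j := a), r j)"])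
      (use assms in \<open>auto simp: PiE_def Pi_def extensional_def\<close>)
  also have "\<dots> = (\<Sum>r\<in>?R. \<Sum>a\<in>B. F r)"
    by (rule sum.cartesian_product[symmetric])
  finally show ?thesis by (simp add: sum_distrib_left)
qed

text \<open>First moment over a random spine \<open>x\<close> with ones at all chosen levels and
  independent seeds \<open>r k\<close>. Every pair in \<open>EP\<close> becomes an edge with
  probability at least \<open>\<beta>\<close>, so some comb does at least as well as this
  average.\<close>

lemma comb_average:
  fixes lev :: "nat \<Rightarrow> nat" and EP :: "(nat \<times> nat) set"
  assumes EP: "EP \<subseteq> {(j, k). j < k \<and> k < n}"
    and lev: "strict_mono_on {..<n} lev" "lev ` {..<n} \<subseteq> {..<d}"
    and dense: "\<And>j b. j < n \<Longrightarrow> b (lev j) \<Longrightarrow>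
      (\<Sum>y\<in>subcube d (lev ` {..<n}) b. up_density E d (lev j) y)
        \<ge> \<beta> * real (card (subcube d (lev ` {..<n}) b))"
  shows "\<exists>z. (\<forall>k<n. z k \<in> cube d) \<and> (\<forall>j k. j < k \<longrightarrow> k < n \<longrightarrow> lex_less (z j) (z k))
    \<and> real (card {p \<in> EP. {z (fst p), z (snd p)} \<in> E}) \<ge> \<beta> * real (card EP)"
proof -
  let ?T = "lev ` {..<n}"
  let ?Q = "subcube d ?T (\<lambda>_. True)"
  let ?R = "PiE {..<n} (\<lambda>_. cube d)"
  define z where "z x r k = branch (lev k) (r k) x" for x :: "bool list" and r :: "nat \<Rightarrow> bool list" and k
  have levd: "lev k < d" if "k < n" for k using lev(2) that by auto
  have levl: "lev j < lev k" if "j < k" "k < n" for j k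
    using lev(1) that by (auto simp: strict_mono_on_def)
  have finEP: "finite EP" by (rule finite_subset[of _ "{..<n} \<times> {..<n}"]) (use EP in auto)
  have finQ: "finite ?Q" by (simp add: subcube_def)
  have finR: "finite ?R" by (intro finite_PiE) auto
  have ne: "?Q \<noteq> {}" "?R \<noteq> {}"
  proof -
    show "?Q \<noteq> {}" using card_subcube[OF lev(2), of "\<lambda>_. True"] by auto
    have "cube d \<noteq> {}" using card_cube[of d] by auto
    then show "?R \<noteq> {}" by (simp add: PiE_eq_empty_iff)
  qed
  let ?I = "\<lambda>x r p. if {z x r (fst p), z x r (snd p)} \<in> E then 1 else (0::real)"
  have pair: "\<beta> * real (card ?R) * real (card ?Q) \<le> (\<Sum>x\<in>?Q. \<Sum>r\<in>?R. ?I x r p)" if p: "p \<in> EP" for p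
  proof -
    obtain j k where jk: "p = (j, k)" "j < k" "k < n" using p EP by auto
    \<comment> \<open>The tooth \<open>z x r k\<close> does not involve the seed of
      \<open>j\<close>, and it agrees with \<open>x\<close> up to \<open>lev j\<close>. Resampling
      the seed of \<open>j\<close> thus gives a uniform point splitting from \<open>z x r k\<close>
      at \<open>lev j\<close>.\<close>
    have inner: "2 ^ d * up_density E d (lev j) (z x r k)
        \<le> (\<Sum>a\<in>cube d. ?I x (r(j := a)) p)" if x: "x \<in> ?Q" for x r
    proof -
      have xc: "x \<in> cube d" and xT: "\<And>m. m < n \<Longrightarrow> x ! lev m"
        using x by (auto simp: subcube_def)
      have agree: "x ! m = z x r k ! m" if "m \<le> lev j" for m
        using that xc levl[OF jk(2,3)] levd[OF jk(3)] by (simp add: z_def nth_branch)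
      have "2 ^ Suc (lev j) * card (nbrs E d (lev j) (z x r k))
          \<le> card {a \<in> cube d. {branch (lev j) a x, z x r k} \<in> E}"
        using xc agree levd[of j] jk by (intro card_branch_edges_ge) (auto simp: z_def)
      then have "real (2 ^ Suc (lev j) * card (nbrs E d (lev j) (z x r k)))
          \<le> real (card {a \<in> cube d. {branch (lev j) a x, z x r k} \<in> E})"
        by (rule of_nat_mono)
      then have "2 ^ Suc (lev j) * real (card (nbrs E d (lev j) (z x r k)))
          \<le> (\<Sum>a\<in>cube d. if {branch (lev j) a x, z x r k} \<in> E then 1 else 0)"
        by (simp add: sum_indicator_eq_card)
      moreover have "(2::real) ^ d = 2 ^ Suc (lev j) * 2 ^ (d - 1 - lev j)"
        using levd[of j] jk by (simp flip: power_add power_Suc)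
      moreover have "z x r k ! lev j" using agree[of "lev j"] xT[of j] jk by simp
      ultimately show ?thesis using jk by (simp add: up_density_def z_def)
    qed
    have outer: "\<beta> * real (card ?Q) \<le> (\<Sum>x\<in>?Q. up_density E d (lev j) (z x r k))" for r
    proof -
      \<comment> \<open>The bits of tooth \<open>k\<close> at the chosen levels while
        \<open>x\<close> runs over \<open>?Q\<close>. Since \<open>lev j\<close> precedes
        \<open>lev k\<close>, its bit is still 1 and \<open>dense\<close> applies.\<close>
      let ?b = "\<lambda>m. True \<noteq> (m = lev k \<or> lev k < m \<and> r k ! m)"
      have "\<beta> * real (card (subcube d ?T ?b)) \<le> (\<Sum>y\<in>subcube d ?T ?b. up_density E d (lev j) y)"
        using levl[OF jk(2,3)] jk by (intro dense) auto
      also have "\<dots> = (\<Sum>x\<in>?Q. up_density E d (lev j) (z x r k))"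
        unfolding z_def by (rule sum_subcube_branch[OF lev(2), symmetric])
      finally show ?thesis using card_subcube[OF lev(2)] by simp
    qed
    \<comment> \<open>The factor \<open>2 ^ d\<close> counts the values of the resampled seed and
      cancels at the end.\<close>
    have "2 ^ d * (\<beta> * real (card ?R) * real (card ?Q)) = 2 ^ d * (\<Sum>r\<in>?R. \<beta> * real (card ?Q))"
      by simp
    also have "\<dots> \<le> 2 ^ d * (\<Sum>r\<in>?R. \<Sum>x\<in>?Q. up_density E d (lev j) (z x r k))"
      by (intro mult_left_mono sum_mono outer) auto
    also have "\<dots> = (\<Sum>x\<in>?Q. \<Sum>r\<in>?R. 2 ^ d * up_density E d (lev j) (z x r k))"
      by (subst sum.swap) (simp add: sum_distrib_left)
    also have "\<dots> \<le> (\<Sum>x\<in>?Q. \<Sum>r\<in>?R. \<Sum>a\<in>cube d. ?I x (r(j := a)) p)"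
      by (intro sum_mono inner)
    also have "\<dots> = (\<Sum>x\<in>?Q. 2 ^ d * (\<Sum>r\<in>?R. ?I x r p))"
      using sum_PiE_resample[of j "{..<n}" "\<lambda>r. ?I _ r p" "cube d"] jk
      by (intro sum.cong refl) (simp add: card_cube)
    also have "\<dots> = 2 ^ d * (\<Sum>x\<in>?Q. \<Sum>r\<in>?R. ?I x r p)" by (simp add: sum_distrib_left)
    finally show ?thesis by simp
  qed
  have "\<exists>w\<in>?Q \<times> ?R. \<beta> * real (card EP) \<le> (\<Sum>p\<in>EP. ?I (fst w) (snd w) p)"
  proof (rule ccontr)
    assume "\<not> ?thesis"
    then have "(\<Sum>w\<in>?Q \<times> ?R. \<Sum>p\<in>EP. ?I (fst w) (snd w) p) < (\<Sum>w\<in>?Q \<times> ?R. \<beta> * real (card EP))"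
      using ne finQ finR by (intro sum_strict_mono) (auto simp: not_le)
    also have "\<dots> = (\<Sum>p\<in>EP. \<beta> * real (card ?R) * real (card ?Q))"
      by (simp add: card_cartesian_product)
    also have "\<dots> \<le> (\<Sum>p\<in>EP. \<Sum>x\<in>?Q. \<Sum>r\<in>?R. ?I x r p)"
      by (intro sum_mono pair)
    also have "\<dots> = (\<Sum>p\<in>EP. \<Sum>w\<in>?Q \<times> ?R. ?I (fst w) (snd w) p)"
      by (simp add: sum.cartesian_product case_prod_unfold)
    also have "\<dots> = (\<Sum>w\<in>?Q \<times> ?R. \<Sum>p\<in>EP. ?I (fst w) (snd w) p)" by (rule sum.swap)
    finally show False by simp
  qed
  then obtain x r where xr: "x \<in> ?Q" "\<beta> * real (card EP) \<le> (\<Sum>p\<in>EP. ?I x r p)" by auto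
  have xc: "x \<in> cube d" and xT: "\<And>m. m < n \<Longrightarrow> x ! lev m" using xr(1) by (auto simp: subcube_def)
  \<comment> \<open>Tooth \<open>j\<close> leaves the spine first and turns a 1 into a 0 there, so
    it is the smaller one. This is why the spine carries ones at the chosen levels.\<close>
  have "lex_less (z x r j) (z x r k)" if jk: "j < k" "k < n" for j k
  proof -
    have "splits_at (lev j) (z x r j) (z x r k)"
      unfolding splits_at_def z_def using xc levl[OF jk] levd[OF jk(2)] by (auto simp: nth_branch)
    moreover have "\<not> z x r j ! lev j" using xc xT[of j] levd[of j] jk by (simp add: z_def nth_branch)
    ultimately show ?thesis by (simp add: lex_less_iff_splits_at)
  qed
  moreover have "z x r k \<in> cube d" for k using xc by (simp add: z_def)
  moreover have "(\<Sum>p\<in>EP. ?I x r p) = real (card {p \<in> EP. {z x r (fst p), z x r (snd p)} \<in> E})"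
    using finEP by (simp add: sum_indicator_eq_card)
  ultimately show ?thesis using xr(2) by (intro exI[of _ "z x r"]) auto
qed


text \<open>Among the rich levels, choose \<open>card VG\<close> many such that, for each of them,
  no large coefficient of its density sits on a set of chosen positions containing another one; then
  average over combs. The constant depends only on \<open>card VG\<close> and
  \<open>\<epsilon>\<close>, hence serves all \<open>\<alpha>\<close>, \<open>d\<close> and
  \<open>E\<close>.\<close>

lemma rich_average_embedding:
  fixes VG :: "nat set"
  assumes G: "is_graph VG EG" and "\<epsilon> > 0"
  shows "\<exists>C. \<forall>\<alpha> d E. is_graph (cube d) E \<and> rich \<alpha> C d E \<longrightarrow>
    (\<exists>\<phi>. \<phi> ` VG \<subseteq> cube d \<and> (\<forall>x\<in>VG. \<forall>y\<in>VG. x < y \<longrightarrow> lex_less (\<phi> x) (\<phi> y))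
      \<and> real (card {e \<in> EG. \<phi> ` e \<in> E}) \<ge> (\<alpha> - \<epsilon>) * real (card EG))"
proof -
  define n where "n = card VG"
  \<comment> \<open>\<open>2 ^ n * \<delta> = \<epsilon>\<close> pays for all subsets of
    \<open>n\<close> chosen levels, and \<open>D\<close> is the Bessel bound on the number of
    coefficients above \<open>\<delta>\<close>.\<close>
  define \<delta> where "\<delta> = \<epsilon> / 2 ^ n"
  define D where "D = nat \<lfloor>1 / \<delta>\<^sup>2\<rfloor>"
  have "\<delta> > 0" using \<open>\<epsilon> > 0\<close> by (simp add: \<delta>_def)
  have finV: "finite VG" using G by (simp add: is_graph_def)
  obtain h where h: "bij_betw h {..<n} VG" "strict_mono_on {..<n} h"
    using ex_bij_betw_strict_mono_card[OF finV] n_def by metis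
  have hl: "h j < h k" if "j < k" "k < n" for j k
    using h(2) that by (auto simp: strict_mono_on_def)
  show ?thesis
  proof (intro exI[of _ "n * (2 * D + 1)"] allI impI)
    fix \<alpha> d E assume "is_graph (cube d) E \<and> rich \<alpha> (n * (2 * D + 1)) d E"
    then have E: "is_graph (cube d) E" and rich: "rich \<alpha> (n * (2 * D + 1)) d E" by auto
    define L where "L = {i. i < d \<and> real (level_edges (Suc i) E) \<ge> \<alpha> * tau (Suc i) d}"
    have "Suc ` L = {l \<in> {1..d}. real (level_edges l E) \<ge> \<alpha> * tau l d}"
    proof (intro subset_antisym subsetI)
      fix l assume "l \<in> {l \<in> {1..d}. real (level_edges l E) \<ge> \<alpha> * tau l d}"
      then show "l \<in> Suc ` L" by (cases l) (auto simp: L_def)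
    qed (auto simp: L_def)
    then have cardL: "n * (2 * D + 1) \<le> card L"
      using rich card_image[of Suc L] by (simp add: rich_def)
    define B where "B i = {S \<in> Pow {..<d}. \<bar>coefficient d (up_density E d i) S\<bar> > \<delta>}" for i
    \<comment> \<open>From each large set \<open>S\<close> one element other than \<open>i\<close>
      is taken; a set \<open>N\<close> avoiding it cannot include \<open>S\<close>. Sets inside
      \<open>{i}\<close> yield an unspecified element, which is harmless since the bound on
      \<open>card (A i)\<close> still holds.\<close>
    define A where "A i = (\<lambda>S. SOME s. s \<in> S - {i}) ` B i" for i
    have "finite (A i) \<and> card (A i) \<le> D" if "i \<in> L" for i
    proof -
      have "finite (B i)" by (simp add: B_def)
      moreover have "real (card (B i)) \<le> 1 / \<delta>\<^sup>2"
        unfolding B_def using that \<open>\<delta> > 0\<close>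
        by (intro card_large_coefficients abs_up_density_le) (auto simp: L_def)
      then have "card (B i) \<le> D" unfolding D_def by (simp add: le_nat_floor)
      ultimately show ?thesis unfolding A_def
        using card_image_le[of "B i" "\<lambda>S. SOME s. s \<in> S - {i}"] by auto
    qed
    then obtain N where N: "N \<subseteq> L" "card N = n" "\<forall>l\<in>N. \<forall>m\<in>N. m \<noteq> l \<longrightarrow> m \<notin> A l"
      using sparse_digraph_independent_set[of L A D n] cardL by (auto simp: L_def)
    have finN: "finite N" using N(1) by (rule finite_subset) (simp add: L_def)
    obtain lev where "bij_betw lev {..<card N} N" and lev: "strict_mono_on {..<card N} lev"
      using ex_bij_betw_strict_mono_card[OF finN] by metis
    then have levN: "lev ` {..<n} = N" by (auto simp: bij_betw_def N(2))
    have Nd: "N \<subseteq> {..<d}" using N(1) by (auto simp: L_def)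
    define EP where "EP = {(j, k). j < k \<and> k < n \<and> {h j, h k} \<in> EG}"
    have dense: "(\<Sum>y\<in>subcube d N b. up_density E d (lev j) y) \<ge> (\<alpha> - \<epsilon>) * real (card (subcube d N b))"
      if j: "j < n" "b (lev j)" for j b
    proof -
      have jN: "lev j \<in> N" using levN j by blast
      have "\<bar>coefficient d (up_density E d (lev j)) S\<bar> \<le> \<delta>" if S: "S \<subseteq> N" "S - {lev j} \<noteq> {}" for S
      proof (rule ccontr)
        assume "\<not> ?thesis"
        then have "S \<in> B (lev j)" using S Nd by (auto simp: B_def)
        then have "(SOME s. s \<in> S - {lev j}) \<in> A (lev j)" by (auto simp: A_def)
        moreover have "(SOME s. s \<in> S - {lev j}) \<in> S - {lev j}" by (rule some_in_eq[THEN iffD2, OF S(2)])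
        ultimately show False using N(3) jN S(1) by blast
      qed
      then have "(\<Sum>y\<in>subcube d N b. up_density E d (lev j) y)
          \<ge> (\<alpha> - 2 ^ card N * \<delta>) * real (card (subcube d N b))"
        using jN N(1) j \<open>\<delta> > 0\<close> by (intro sum_up_density_subcube_ge[OF E Nd]) (auto simp: L_def)
      then show ?thesis by (simp add: \<delta>_def N(2))
    qed
    obtain z where z: "\<forall>k<n. z k \<in> cube d" "\<forall>j k. j < k \<longrightarrow> k < n \<longrightarrow> lex_less (z j) (z k)"
      "real (card {p \<in> EP. {z (fst p), z (snd p)} \<in> E}) \<ge> (\<alpha> - \<epsilon>) * real (card EP)"
      using comb_average[of EP n lev d "\<alpha> - \<epsilon>" E] lev dense Nd
      unfolding levN by (auto simp: EP_def N(2))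
    define \<phi> where "\<phi> = z \<circ> inv_into {..<n} h"
    have \<phi>h: "\<phi> (h k) = z k" if "k < n" for k
      using h(1) that by (simp add: \<phi>_def bij_betw_def)
    have onto: "\<exists>k<n. v = h k" if "v \<in> VG" for v
      using h(1) that by (auto simp: bij_betw_def)
    let ?f = "\<lambda>(j, k). {h j, h k}"
    have bij: "bij_betw ?f EP EG"
    proof (rule bij_betw_imageI)
      show "inj_on ?f EP"
      proof (rule inj_onI, clarify)
        fix j k j' k' assume p: "(j, k) \<in> EP" "(j', k') \<in> EP" and eq: "{h j, h k} = {h j', h k'}"
        have "h j < h k" "h j' < h k'" using p hl by (auto simp: EP_def)
        then have "h j = h j'" "h k = h k'" using eq by (auto simp: doubleton_eq_iff)
        then show "j = j' \<and> k = k'"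
          using h(1) p by (auto simp: EP_def bij_betw_def inj_on_def)
      qed
      show "?f ` EP = EG"
      proof (intro subset_antisym subsetI)
        fix e assume e: "e \<in> EG"
        then obtain u v where uv: "e = {u, v}" "u \<noteq> v" "u \<in> VG" "v \<in> VG"
          using G by (auto simp: is_graph_def)
        then obtain j k where jk: "j < n" "k < n" "u = h j" "v = h k" using onto by metis
        consider "j < k" | "k < j" using jk uv by fastforce
        then show "e \<in> ?f ` EP"
        proof cases
          case 1
          then show ?thesis using e uv jk by (auto simp: EP_def intro!: image_eqI[where x = "(j, k)"])
        next
          case 2
          then show ?thesis using e uv jk
            by (auto simp: EP_def insert_commute intro!: image_eqI[where x = "(k, j)"])
        qed
      qed (auto simp: EP_def)
    qed
    have "?f ` {p \<in> EP. {z (fst p), z (snd p)} \<in> E} \<subseteq> {e \<in> EG. \<phi> ` e \<in> E}"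
      by (auto simp: EP_def \<phi>h)
    moreover have "inj_on ?f {p \<in> EP. {z (fst p), z (snd p)} \<in> E}"
      using bij by (auto simp: bij_betw_def intro: inj_on_subset)
    moreover have "finite EG" by (rule finite_edges[OF G])
    ultimately have "card {p \<in> EP. {z (fst p), z (snd p)} \<in> E} \<le> card {e \<in> EG. \<phi> ` e \<in> E}"
      by (intro card_inj_on_le) auto
    moreover have "card EP = card EG" using bij by (rule bij_betw_same_card)
    ultimately have "(\<alpha> - \<epsilon>) * real (card EG) \<le> real (card {e \<in> EG. \<phi> ` e \<in> E})"
      using z(3) by simp
    moreover have "\<phi> ` VG \<subseteq> cube d" using onto z(1) \<phi>h by fastforce
    moreover have "lex_less (\<phi> x) (\<phi> y)" if xy: "x \<in> VG" "y \<in> VG" "x < y" for x y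
    proof -
      obtain j k where jk: "j < n" "k < n" "x = h j" "y = h k" using onto xy by metis
      have "j < k" using hl[of k j] jk xy(3) by (metis less_asym less_irrefl linorder_neqE_nat)
      then show ?thesis using z(2) jk by (simp add: \<phi>h)
    qed
    ultimately show "\<exists>\<phi>. \<phi> ` VG \<subseteq> cube d \<and> (\<forall>x\<in>VG. \<forall>y\<in>VG. x < y \<longrightarrow> lex_less (\<phi> x) (\<phi> y))
        \<and> real (card {e \<in> EG. \<phi> ` e \<in> E}) \<ge> (\<alpha> - \<epsilon>) * real (card EG)"
      by blast
  qed
qed

section \<open>Balanced blow-ups of the cube\<close>

definition cube_pairs :: "nat \<Rightarrow> bool list set set" where
  "cube_pairs d = {e. \<exists>u v. e = {u, v} \<and> u \<noteq> v \<and> u \<in> cube d \<and> v \<in> cube d}"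

text \<open>\<open>delta\<close> is symmetric, so both orderings of a pair of distinct points give
  the same level and \<open>THE\<close> is well defined on it.\<close>

definition pair_level :: "bool list set \<Rightarrow> nat" where
  "pair_level e = (THE l. \<exists>u v. e = {u, v} \<and> u \<noteq> v \<and> delta u v = l)"

lemma pair_level_doubleton: "u \<noteq> v \<Longrightarrow> pair_level {u, v} = delta u v"
  unfolding pair_level_def by (rule the_equality) (auto simp: doubleton_eq_iff delta_sym)

lemma cube_pairsI: "u \<noteq> v \<Longrightarrow> u \<in> cube d \<Longrightarrow> v \<in> cube d \<Longrightarrow> {u, v} \<in> cube_pairs d"
  by (auto simp only: cube_pairs_def)

lemma cube_pairsE:
  assumes "e \<in> cube_pairs d"
  obtains u v where "e = {u, v}" "u \<noteq> v" "u \<in> cube d" "v \<in> cube d"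
  using assms by (auto simp: cube_pairs_def)

lemma is_graph_cube_iff: "is_graph (cube d) E \<longleftrightarrow> E \<subseteq> cube_pairs d"
  by (simp add: is_graph_def cube_pairs_def)

lemma finite_cube_pairs: "finite (cube_pairs d)"
  by (rule finite_subset[of _ "Pow (cube d)"]) (auto simp: cube_pairs_def)

lemma pair_level_bounds:
  assumes "e \<in> cube_pairs d"
  shows "pair_level e \<in> {1..d}"
proof -
  obtain u v where uv: "e = {u, v}" "u \<noteq> v" "u \<in> cube d" "v \<in> cube d"
    using assms by (auto simp: cube_pairs_def)
  then obtain i where "i < d" "splits_at i u v" using splits_at_exists by blast
  then show ?thesis using uv by (simp add: pair_level_doubleton delta_eq_if_splits_at)
qed

text \<open>Grouping edges by level turns the sum of level densities into an additive edge weight,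
  which can be averaged over copies of the cube.\<close>

lemma sum_level_densities:
  assumes "is_graph (cube d) E"
  shows "(\<Sum>l = 1..d. real (level_edges l E) / tau l d) = (\<Sum>e\<in>E. 1 / tau (pair_level e) d)"
proof -
  have E: "E \<subseteq> cube_pairs d" using assms by (simp add: is_graph_cube_iff)
  have fin: "finite E" using E finite_cube_pairs finite_subset by blast
  have "{e \<in> E. \<exists>u v. e = {u, v} \<and> u \<noteq> v \<and> delta u v = l} = {e \<in> E. pair_level e = l}" for l
  proof (rule Collect_cong, rule conj_cong[OF refl])
    fix e assume "e \<in> E"
    with E have "e \<in> cube_pairs d" by (rule subsetD)
    then obtain u v where uv: "e = {u, v}" "u \<noteq> v" by (rule cube_pairsE)
    then show "(\<exists>u v. e = {u, v} \<and> u \<noteq> v \<and> delta u v = l) \<longleftrightarrow> pair_level e = l"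
      by (metis pair_level_doubleton)
  qed
  then have "(\<Sum>l = 1..d. real (level_edges l E) / tau l d)
      = (\<Sum>l = 1..d. \<Sum>e\<in>{e \<in> E. pair_level e = l}. 1 / tau (pair_level e) d)"
    by (simp add: level_edges_def)
  also have "\<dots> = (\<Sum>e\<in>E. 1 / tau (pair_level e) d)"
    using E pair_level_bounds by (intro sum.group fin) auto
  finally show ?thesis .
qed

lemma level_edges_cube_pairs:
  assumes "l \<in> {1..d}"
  shows "real (level_edges l (cube_pairs d)) = tau l d"
proof -
  obtain i where i: "l = Suc i" "i < d" using assms by (cases l) auto
  have "nbrs (cube_pairs d) d i y = {z \<in> cube d. splits_at i z y}" if "y \<in> cube d" for y
    unfolding nbrs_def by (rule Collect_cong) (metis that cube_pairsI splits_at_neq)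
  then have "level_edges l (cube_pairs d) = (\<Sum>y\<in>subcube d {i} (\<lambda>_. True). 2 ^ (d - 1 - i))"
    unfolding i(1) using i(2)
    by (subst level_edges_eq_sum) (auto simp: is_graph_cube_iff subcube_def card_splits_at)
  then show ?thesis using i by (simp add: tau_Suc)
qed

lemma sum_cube_pairs: "(\<Sum>e\<in>cube_pairs d. 1 / tau (pair_level e) d) = real d"
proof -
  have "(\<Sum>e\<in>cube_pairs d. 1 / tau (pair_level e) d)
      = (\<Sum>l = 1..d. real (level_edges l (cube_pairs d)) / tau l d)"
    by (rule sum_level_densities[symmetric]) (simp add: is_graph_cube_iff)
  also have "\<dots> = (\<Sum>l = 1..d. 1)"
    by (rule sum.cong) (use tau_pos in \<open>auto simp: level_edges_cube_pairs less_imp_neq[symmetric]\<close>)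
  finally show ?thesis by simp
qed

section \<open>A strictly monotone map from the cube to the naturals\<close>

fun bin_value :: "bool list \<Rightarrow> nat" where
  "bin_value [] = 0"
| "bin_value (b # x) = (if b then 2 ^ length x else 0) + bin_value x"

lemma bin_value_less: "bin_value x < 2 ^ length x"
  by (induction x) auto

text \<open>The first differing bit outweighs all later bits together, by
  \<open>bin_value_less\<close>.\<close>

lemma bin_value_splits_at:
  "length x = length y \<Longrightarrow> i < length x \<Longrightarrow> splits_at i x y \<Longrightarrow> \<not> x ! i \<Longrightarrow> bin_value x < bin_value y"
proof (induction x arbitrary: y i)
  case (Cons a x)
  then obtain b y' where y: "y = b # y'" by (cases y) auto
  show ?case
  proof (cases i)
    case 0
    then have "\<not> a" "b" using Cons.prems y by (auto simp: splits_at_def)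
    then show ?thesis using bin_value_less[of x] Cons.prems(1) y by simp
  next
    case (Suc k)
    have "a = b" using Cons.prems(3) y Suc by (auto simp: splits_at_def)
    moreover have "splits_at k x y'"
      using Cons.prems(3) y Suc unfolding splits_at_def by (metis Suc_less_eq nth_Cons_Suc)
    ultimately show ?thesis using Cons.IH[of y' k] Cons.prems y Suc by simp
  qed
qed simp

lemma bin_value_mono:
  assumes "x \<in> cube d" "y \<in> cube d" "lex_less x y"
  shows "bin_value x < bin_value y"
proof -
  obtain i where i: "i < d" "splits_at i x y"
    using assms splits_at_exists by (metis lex_less_def)
  then have "\<not> x ! i" using assms(3) lex_less_iff_splits_at by blast
  then show ?thesis using i assms by (intro bin_value_splits_at) (auto simp: cube_def)
qed

text \<open>Such a set is determined by its trace on \<open>J\<close>, which is arbitrary.\<close>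

lemma card_Pow_agree_outside:
  assumes "J \<subseteq> I" "\<omega>\<^sub>0 \<subseteq> I" "finite J"
  shows "card {\<omega> \<in> Pow I. \<omega> - J = \<omega>\<^sub>0 - J} = 2 ^ card J"
proof -
  have "bij_betw (\<lambda>\<omega>. \<omega> \<inter> J) {\<omega> \<in> Pow I. \<omega> - J = \<omega>\<^sub>0 - J} (Pow J)"
    by (rule bij_betw_byWitness[where f' = "\<lambda>s. s \<union> (\<omega>\<^sub>0 - J)"]) (use assms in auto)
  then show ?thesis using assms by (simp add: bij_betw_same_card card_Pow)
qed

text \<open>The copies of \<open>u\<close> are indexed by the bits \<open>\<omega> - T u\<close> that \<open>u\<close> can see, and a pair of
  level \<open>l\<close> has \<open>d - l\<close> private bits that neither of its ends sees. So an edge of the blow-up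
  above a level \<open>l\<close> pair comes from exactly \<open>2 ^ (d - l)\<close> choices of \<open>\<omega>\<close>, a number proportional
  to \<open>tau l d\<close>.\<close>

lemma balanced_blowup:
  assumes "d > 0"
  obtains VH EH and \<Omega> :: "(bool list set \<times> nat) set set" and \<phi> :: "_ \<Rightarrow> bool list \<Rightarrow> nat"
  where "is_graph VH EH" "EH \<noteq> {}"
    and "\<And>\<omega>. \<omega> \<in> \<Omega> \<Longrightarrow> \<phi> \<omega> ` cube d \<subseteq> VH"
    and "\<And>\<omega> u v. \<omega> \<in> \<Omega> \<Longrightarrow> u \<in> cube d \<Longrightarrow> v \<in> cube d \<Longrightarrow> lex_less u v \<Longrightarrow> \<phi> \<omega> u < \<phi> \<omega> v"
    and "\<And>\<omega> e. \<omega> \<in> \<Omega> \<Longrightarrow> e \<in> cube_pairs d \<Longrightarrow> \<phi> \<omega> ` e \<in> EH"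
    and "\<And>f. f \<in> EH \<Longrightarrow>
      (\<Sum>\<omega>\<in>\<Omega>. \<Sum>e\<in>{e \<in> cube_pairs d. \<phi> \<omega> ` e = f}. 1 / tau (pair_level e) d) = 2 / 2 ^ d"
proof -
  define I where "I = Sigma (cube_pairs d) (\<lambda>e. {..<d - pair_level e})"
  define T where "T u = {p \<in> I. u \<in> fst p}" for u
  define K where "K = card (Pow I)"
  have finI: "finite I" using finite_cube_pairs by (auto simp: I_def)
  then have finPow: "finite (Pow I)" by simp
  obtain c where c: "bij_betw c (Pow I) {0..<K}"
    using ex_bij_betw_finite_nat[OF finPow] K_def by auto
  \<comment> \<open>Every cube vertex owns a block of \<open>K\<close> consecutive numbers, and the
    bits it sees select a number in the block. Blocks follow the lexicographic order, so copies
    compare correctly even for different \<open>\<omega>\<close>.\<close>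
  define \<phi> where "\<phi> \<omega> u = bin_value u * K + c (\<omega> - T u)" for \<omega> u
  have cK: "c (\<omega> - T u) < K" if "\<omega> \<in> Pow I" for \<omega> u
  proof -
    have "\<omega> - T u \<in> Pow I" using that by auto
    then show ?thesis using bij_betwE[OF c] by (metis atLeastLessThan_iff)
  qed
  have mono: "\<phi> \<omega> u < \<phi> \<omega>' v"
    if "\<omega> \<in> Pow I" "\<omega>' \<in> Pow I" "u \<in> cube d" "v \<in> cube d" "lex_less u v" for \<omega> \<omega>' u v
  proof -
    have "Suc (bin_value u) * K \<le> bin_value v * K"
      using bin_value_mono[OF that(3,4,5)] by (intro mult_le_mono1) auto
    then show ?thesis using cK[OF that(1), of u] by (simp add: \<phi>_def)
  qed
  have inj: "u = v \<and> \<omega> - T u = \<omega>' - T u"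
    if "\<omega> \<in> Pow I" "\<omega>' \<in> Pow I" "u \<in> cube d" "v \<in> cube d" "\<phi> \<omega> u = \<phi> \<omega>' v" for \<omega> \<omega>' u v
  proof -
    have "u = v" using mono lex_less_total that by (metis less_irrefl)
    then have "c (\<omega> - T u) = c (\<omega>' - T u)" using that(5) by (simp add: \<phi>_def)
    moreover have "\<omega> - T u \<in> Pow I" "\<omega>' - T u \<in> Pow I" using that by auto
    ultimately show ?thesis using c \<open>u = v\<close> by (auto simp: bij_betw_def dest: inj_onD)
  qed
  define VH where "VH = (\<lambda>(\<omega>, u). \<phi> \<omega> u) ` (Pow I \<times> cube d)"
  define EH where "EH = (\<lambda>(\<omega>, e). \<phi> \<omega> ` e) ` (Pow I \<times> cube_pairs d)"
  have "is_graph VH EH"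
    unfolding is_graph_def
  proof (intro conjI subsetI)
    show "finite VH" using finI by (simp add: VH_def)
    fix f assume "f \<in> EH"
    then obtain \<omega> u v where f: "\<omega> \<in> Pow I" "f = \<phi> \<omega> ` {u, v}" "u \<noteq> v" "u \<in> cube d" "v \<in> cube d"
      by (auto simp: EH_def cube_pairs_def)
    then have "\<phi> \<omega> u \<noteq> \<phi> \<omega> v" using inj by blast
    moreover have "\<phi> \<omega> u \<in> VH" "\<phi> \<omega> v \<in> VH" using f by (auto simp: VH_def)
    ultimately show "f \<in> {e. \<exists>u v. e = {u, v} \<and> u \<noteq> v \<and> u \<in> VH \<and> v \<in> VH}"
      using f(2) by auto
  qed
  moreover have "EH \<noteq> {}"
  proof -
    have "replicate d True \<noteq> replicate d False" using assms by (cases d) auto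
    then have "{replicate d True, replicate d False} \<in> cube_pairs d"
      by (rule cube_pairsI) (simp_all add: cube_def)
    then show ?thesis by (auto simp: EH_def)
  qed
  moreover have "\<phi> \<omega> ` cube d \<subseteq> VH" if "\<omega> \<in> Pow I" for \<omega>
    using that by (auto simp: VH_def)
  moreover have "\<phi> \<omega> ` e \<in> EH" if "\<omega> \<in> Pow I" "e \<in> cube_pairs d" for \<omega> e
    using that by (auto simp: EH_def)
  moreover have "(\<Sum>\<omega>\<in>Pow I. \<Sum>e\<in>{e \<in> cube_pairs d. \<phi> \<omega> ` e = f}. 1 / tau (pair_level e) d) = 2 / 2 ^ d"
    if f: "f \<in> EH" for f
  proof -
    obtain \<omega>\<^sub>0 e\<^sub>0 where w0: "\<omega>\<^sub>0 \<in> Pow I" and e0: "e\<^sub>0 \<in> cube_pairs d" and f_eq: "f = \<phi> \<omega>\<^sub>0 ` e\<^sub>0"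
      using f by (auto simp: EH_def)
    obtain u v where uv: "e\<^sub>0 = {u, v}" "u \<noteq> v" "u \<in> cube d" "v \<in> cube d"
      using e0 by (rule cube_pairsE)
    \<comment> \<open>The bits hidden from both ends of \<open>e\<^sub>0\<close>. They belong to
      pairs containing both \<open>u\<close> and \<open>v\<close>, and \<open>e\<^sub>0\<close> is
      the only such pair.\<close>
    define J where "J = T u \<inter> T v"
    have J: "J = {e\<^sub>0} \<times> {..<d - pair_level e\<^sub>0}"
    proof -
      have iff: "u \<in> e \<and> v \<in> e \<longleftrightarrow> e = e\<^sub>0" if "e \<in> cube_pairs d" for e
        using that uv(1,2) by (elim cube_pairsE) auto
      have "p \<in> J \<longleftrightarrow> fst p \<in> cube_pairs d \<and> snd p < d - pair_level (fst p) \<and> (u \<in> fst p \<and> v \<in> fst p)" for p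
        unfolding J_def T_def I_def by (cases p) auto
      then have "p \<in> J \<longleftrightarrow> fst p = e\<^sub>0 \<and> snd p < d - pair_level e\<^sub>0" for p
        using iff e0 by metis
      then show ?thesis by (auto simp: set_eq_iff)
    qed
    \<comment> \<open>An edge of the blow-up determines its underlying pair and every bit seen by at
      least one end, leaving only the bits in \<open>J\<close> open.\<close>
    have fibre: "e = e\<^sub>0 \<and> \<omega> - J = \<omega>\<^sub>0 - J"
      if w: "\<omega> \<in> Pow I" and e: "e \<in> cube_pairs d" and eq: "\<phi> \<omega> ` e = f" for \<omega> e
    proof -
      obtain a b where ab: "e = {a, b}" "a \<noteq> b" "a \<in> cube d" "b \<in> cube d"
        using e by (rule cube_pairsE)
      have "{\<phi> \<omega> a, \<phi> \<omega> b} = {\<phi> \<omega>\<^sub>0 u, \<phi> \<omega>\<^sub>0 v}" using eq ab uv f_eq by simp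
      then consider "\<phi> \<omega> a = \<phi> \<omega>\<^sub>0 u" "\<phi> \<omega> b = \<phi> \<omega>\<^sub>0 v" | "\<phi> \<omega> a = \<phi> \<omega>\<^sub>0 v" "\<phi> \<omega> b = \<phi> \<omega>\<^sub>0 u"
        by (auto simp: doubleton_eq_iff)
      then have "e = e\<^sub>0 \<and> \<omega> - T u = \<omega>\<^sub>0 - T u \<and> \<omega> - T v = \<omega>\<^sub>0 - T v"
      proof cases
        case 1
        then show ?thesis
          using inj[OF w w0 ab(3) uv(3)] inj[OF w w0 ab(4) uv(4)] ab(1) uv(1) by auto
      next
        case 2
        then show ?thesis
          using inj[OF w w0 ab(3) uv(4)] inj[OF w w0 ab(4) uv(3)] ab(1) uv(1) by auto
      qed
      then show ?thesis unfolding J_def by blast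
    qed
    have fibre': "\<phi> \<omega> ` e\<^sub>0 = f" if "\<omega> - J = \<omega>\<^sub>0 - J" for \<omega>
    proof -
      have "\<omega> - T u = \<omega>\<^sub>0 - T u" "\<omega> - T v = \<omega>\<^sub>0 - T v" using that unfolding J_def by blast+
      then show ?thesis using uv f_eq by (simp add: \<phi>_def)
    qed
    have "(\<Sum>\<omega>\<in>Pow I. \<Sum>e\<in>{e \<in> cube_pairs d. \<phi> \<omega> ` e = f}. 1 / tau (pair_level e) d)
        = (\<Sum>\<omega>\<in>Pow I. if \<omega> - J = \<omega>\<^sub>0 - J then 1 / tau (pair_level e\<^sub>0) d else 0)"
    proof (rule sum.cong[OF refl])
      fix \<omega> assume w: "\<omega> \<in> Pow I"
      have "{e \<in> cube_pairs d. \<phi> \<omega> ` e = f} = (if \<omega> - J = \<omega>\<^sub>0 - J then {e\<^sub>0} else {})"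
      proof (rule set_eqI)
        fix e
        have "e \<in> cube_pairs d \<and> \<phi> \<omega> ` e = f \<longleftrightarrow> e = e\<^sub>0 \<and> \<omega> - J = \<omega>\<^sub>0 - J"
          using fibre[OF w, of e] fibre'[of \<omega>] e0 by metis
        then show "e \<in> {e \<in> cube_pairs d. \<phi> \<omega> ` e = f}
            \<longleftrightarrow> e \<in> (if \<omega> - J = \<omega>\<^sub>0 - J then {e\<^sub>0} else {})" by simp
      qed
      then show "(\<Sum>e\<in>{e \<in> cube_pairs d. \<phi> \<omega> ` e = f}. 1 / tau (pair_level e) d)
          = (if \<omega> - J = \<omega>\<^sub>0 - J then 1 / tau (pair_level e\<^sub>0) d else 0)" by simp
    qed
    also have "\<dots> = (\<Sum>\<omega>\<in>{\<omega> \<in> Pow I. \<omega> - J = \<omega>\<^sub>0 - J}. 1 / tau (pair_level e\<^sub>0) d)"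
      by (rule sum.inter_filter[OF finPow, symmetric])
    also have "\<dots> = real (card {\<omega> \<in> Pow I. \<omega> - J = \<omega>\<^sub>0 - J}) / tau (pair_level e\<^sub>0) d" by simp
    also have "card {\<omega> \<in> Pow I. \<omega> - J = \<omega>\<^sub>0 - J} = 2 ^ card J"
      using w0 finI by (intro card_Pow_agree_outside) (auto simp: J_def T_def)
    also have "card J = d - pair_level e\<^sub>0" by (simp add: J card_cartesian_product)
    also have "real (2 ^ (d - pair_level e\<^sub>0)) / tau (pair_level e\<^sub>0) d = 2 / 2 ^ d"
    proof -
      have "(d - pair_level e\<^sub>0) + d = Suc (2 * d - pair_level e\<^sub>0 - 1)"
        using pair_level_bounds[OF e0] by auto
      then have "(2::real) ^ (d - pair_level e\<^sub>0) * 2 ^ d = 2 * tau (pair_level e\<^sub>0) d"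
        unfolding tau_def by (metis power_add power_Suc)
      then show ?thesis using tau_pos[of "pair_level e\<^sub>0" d] by (simp add: field_simps)
    qed
    finally show ?thesis .
  qed
  ultimately show ?thesis
    using mono by (intro that[of VH EH "Pow I" \<phi>])
qed

section \<open>Bounds for the relative density and for \<open>rho\<close>\<close>

lemma rho_FG_nonneg: "is_graph VG EG \<Longrightarrow> rho_FG VF EF VG EG \<ge> 0"
  and rho_FG_less_contains: "is_graph VG EG \<Longrightarrow> E' \<subseteq> EG \<Longrightarrow> rho_FG VF EF VG EG * real (card EG) < real (card E')
    \<Longrightarrow> ord_contains VF EF VG (<) E'"
  and rho_FG_le: "is_graph VG EG \<Longrightarrow> \<alpha> \<ge> 0 \<Longrightarrow> (\<And>E'. E' \<subseteq> EG \<Longrightarrow> \<not> ord_contains VF EF VG (<) E'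
    \<Longrightarrow> real (card E') / real (card EG) \<le> \<alpha>) \<Longrightarrow> rho_FG VF EF VG EG \<le> \<alpha>"
proof -
  assume G: "is_graph VG EG"
  define S where "S = {real (card E') / real (card EG) | E'. E' \<subseteq> EG \<and> \<not> ord_contains VF EF VG (<) E'}"
  have finE: "finite EG" by (rule finite_edges[OF G])
  have "S \<subseteq> (\<lambda>E'. real (card E') / real (card EG)) ` Pow EG" by (auto simp: S_def)
  then have finS: "finite S" by (rule finite_subset) (simp add: finE)
  have rho: "rho_FG VF EF VG EG = (if S = {} then 0 else Max S)"
    by (simp only: rho_FG_def S_def Let_def)
  show "rho_FG VF EF VG EG \<ge> 0"
  proof (cases "S = {}")
    case False
    then have "Max S \<in> S" using finS by simp
    then show ?thesis using False by (auto simp: rho S_def)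
  qed (simp add: rho)
  \<comment> \<open>The empty family has the value 0 by convention, which
    \<open>\<alpha> \<ge> 0\<close> covers.\<close>
  show "rho_FG VF EF VG EG \<le> \<alpha>"
    if "\<alpha> \<ge> 0" "\<And>E'. E' \<subseteq> EG \<Longrightarrow> \<not> ord_contains VF EF VG (<) E' \<Longrightarrow> real (card E') / real (card EG) \<le> \<alpha>"
  proof (cases "S = {}")
    case False
    then show ?thesis using finS that by (auto simp: rho S_def)
  qed (simp add: rho that)
  show "ord_contains VF EF VG (<) E'"
    if E': "E' \<subseteq> EG" "rho_FG VF EF VG EG * real (card EG) < real (card E')"
  proof (rule ccontr)
    assume "\<not> ?thesis"
    then have mem: "real (card E') / real (card EG) \<in> S" using E' by (auto simp: S_def)
    then have "real (card E') / real (card EG) \<le> rho_FG VF EF VG EG"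
      using finS by (auto simp: rho)
    \<comment> \<open>Without edges both sides of the strict inequality would be 0.\<close>
    moreover have "card EG > 0"
    proof (rule ccontr)
      assume "\<not> card EG > 0"
      then have "card E' = 0" using E'(1) card_mono[OF finE, of E'] by simp
      then show False using E'(2) \<open>\<not> card EG > 0\<close> by simp
    qed
    ultimately show False using E'(2) by (simp add: field_simps)
  qed
qed

lemma rho_le:
  assumes "is_graph VG EG" "card EG > 0"
  shows "rho VF EF \<le> rho_FG VF EF VG EG"
  unfolding rho_def
  by (rule cInf_lower) (use assms in \<open>auto intro!: bdd_belowI[of _ 0] simp: rho_FG_nonneg\<close>)

text \<open>Injectivity of the composite comes from strict monotonicity together with irreflexivity
  of \<open>lt'\<close>.\<close>

lemma ord_contains_trans:
  assumes F: "ord_contains VF EF V lt E" and \<phi>: "\<phi> ` V \<subseteq> V'"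
    and mono: "\<And>x y. x \<in> V \<Longrightarrow> y \<in> V \<Longrightarrow> lt x y \<Longrightarrow> lt' (\<phi> x) (\<phi> y)"
    and edges: "\<And>e. e \<in> E \<Longrightarrow> \<phi> ` e \<in> E'"
    and irrefl: "\<And>x. \<not> lt' x x"
  shows "ord_contains VF EF V' lt' E'"
proof -
  obtain f where f: "f ` VF \<subseteq> V" "\<forall>x\<in>VF. \<forall>y\<in>VF. x < y \<longrightarrow> lt (f x) (f y)" "\<forall>e\<in>EF. f ` e \<in> E"
    using F by (auto simp: ord_contains_def)
  have lt: "lt' (\<phi> (f x)) (\<phi> (f y))" if "x \<in> VF" "y \<in> VF" "x < y" for x y
    using that f(1,2) by (intro mono) auto
  have "inj_on (\<phi> \<circ> f) VF"
  proof (rule inj_onI)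
    fix x y assume xy: "x \<in> VF" "y \<in> VF" "(\<phi> \<circ> f) x = (\<phi> \<circ> f) y"
    show "x = y"
    proof (rule ccontr)
      assume "x \<noteq> y"
      then consider "x < y" | "y < x" by linarith
      then show False using lt[of x y] lt[of y x] irrefl[of "\<phi> (f x)"] xy by cases auto
    qed
  qed
  moreover have "(\<phi> \<circ> f) ` e \<in> E'" if "e \<in> EF" for e
    using that f(3) edges[of "f ` e"] by (simp add: image_comp)
  ultimately show ?thesis
    unfolding ord_contains_def using f(1) \<phi> lt by (intro exI[of _ "\<phi> \<circ> f"]) auto
qed

text \<open>An \<open>F\<close>-free subgraph of the blow-up pulls back along every map to an
  \<open>F\<close>-free cube graph, of weight at most \<open>\<alpha> * d\<close>. Every edge of the
  blow-up carries the same total weight over \<open>\<Omega>\<close>, so summing over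
  \<open>\<Omega>\<close> bounds the proportion of edges by \<open>\<alpha>\<close>.\<close>

lemma rho_le_average_threshold:
  assumes "d > 0" "\<alpha> \<ge> 0"
    and contains: "\<And>E. is_graph (cube d) E \<Longrightarrow>
      (1 / real d) * (\<Sum>l = 1..d. real (level_edges l E) / tau l d) \<ge> \<alpha> \<Longrightarrow>
      ord_contains VF EF (cube d) lex_less E"
  shows "rho VF EF \<le> \<alpha>"
proof -
  obtain VH EH and \<Omega> :: "(bool list set \<times> nat) set set" and \<phi> :: "_ \<Rightarrow> bool list \<Rightarrow> nat"
    where H: "is_graph VH EH" "EH \<noteq> {}"
    and \<phi>: "\<And>\<omega>. \<omega> \<in> \<Omega> \<Longrightarrow> \<phi> \<omega> ` cube d \<subseteq> VH"
      "\<And>\<omega> u v. \<omega> \<in> \<Omega> \<Longrightarrow> u \<in> cube d \<Longrightarrow> v \<in> cube d \<Longrightarrow> lex_less u v \<Longrightarrow> \<phi> \<omega> u < \<phi> \<omega> v"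
      "\<And>\<omega> e. \<omega> \<in> \<Omega> \<Longrightarrow> e \<in> cube_pairs d \<Longrightarrow> \<phi> \<omega> ` e \<in> EH"
    and fibre: "\<And>f. f \<in> EH \<Longrightarrow>
      (\<Sum>\<omega>\<in>\<Omega>. \<Sum>e\<in>{e \<in> cube_pairs d. \<phi> \<omega> ` e = f}. 1 / tau (pair_level e) d) = 2 / 2 ^ d"
    by (rule balanced_blowup[OF \<open>d > 0\<close>]) (rule that; assumption)
  have finE: "finite EH" by (rule finite_edges[OF H(1)])
  define pull where "pull E' \<omega> = {e \<in> cube_pairs d. \<phi> \<omega> ` e \<in> E'}" for E' \<omega>
  have count: "(\<Sum>\<omega>\<in>\<Omega>. \<Sum>e\<in>pull E' \<omega>. 1 / tau (pair_level e) d) = real (card E') * (2 / 2 ^ d)"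
    if E': "E' \<subseteq> EH" for E'
  proof -
    have finE': "finite E'" using E' finE finite_subset by blast
    have "(\<Sum>e\<in>pull E' \<omega>. 1 / tau (pair_level e) d)
        = (\<Sum>f\<in>E'. \<Sum>e\<in>{e \<in> cube_pairs d. \<phi> \<omega> ` e = f}. 1 / tau (pair_level e) d)" for \<omega>
    proof -
      have "(\<Sum>e\<in>pull E' \<omega>. 1 / tau (pair_level e) d)
          = (\<Sum>f\<in>E'. \<Sum>e\<in>{e \<in> pull E' \<omega>. \<phi> \<omega> ` e = f}. 1 / tau (pair_level e) d)"
        by (rule sum.group[symmetric]) (auto simp: pull_def finite_cube_pairs finE')
      also have "\<dots> = (\<Sum>f\<in>E'. \<Sum>e\<in>{e \<in> cube_pairs d. \<phi> \<omega> ` e = f}. 1 / tau (pair_level e) d)"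
        by (intro sum.cong refl) (auto simp: pull_def)
      finally show ?thesis .
    qed
    then have "(\<Sum>\<omega>\<in>\<Omega>. \<Sum>e\<in>pull E' \<omega>. 1 / tau (pair_level e) d)
        = (\<Sum>f\<in>E'. \<Sum>\<omega>\<in>\<Omega>. \<Sum>e\<in>{e \<in> cube_pairs d. \<phi> \<omega> ` e = f}. 1 / tau (pair_level e) d)"
      by (simp only: sum.swap[of _ E'])
    also have "\<dots> = (\<Sum>f\<in>E'. 2 / 2 ^ d)" using E' fibre by (intro sum.cong refl) blast
    finally show ?thesis by simp
  qed
  have "pull EH \<omega> = cube_pairs d" if "\<omega> \<in> \<Omega>" for \<omega> using that \<phi>(3) by (auto simp: pull_def)
  \<comment> \<open>For \<open>E' = EH\<close> every pull-back is complete and weighs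
    \<open>d\<close>, which ties \<open>card EH\<close> to \<open>card \<Omega>\<close>.\<close>
  then have total: "real (card EH) * (2 / 2 ^ d) = real (card \<Omega>) * real d"
    using count[of EH] by (simp add: sum_cube_pairs)
  have "card EH > 0" using H(2) finE by (simp add: card_gt_0_iff)
  have "rho_FG VF EF VH EH \<le> \<alpha>"
  proof (rule rho_FG_le[OF H(1) \<open>\<alpha> \<ge> 0\<close>])
    fix E' assume E': "E' \<subseteq> EH" "\<not> ord_contains VF EF VH (<) E'"
    have "(\<Sum>e\<in>pull E' \<omega>. 1 / tau (pair_level e) d) \<le> \<alpha> * real d" if w: "\<omega> \<in> \<Omega>" for \<omega>
    proof (rule ccontr)
      assume "\<not> ?thesis"
      moreover have g: "is_graph (cube d) (pull E' \<omega>)" by (auto simp: is_graph_cube_iff pull_def)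
      ultimately have "(1 / real d) * (\<Sum>l = 1..d. real (level_edges l (pull E' \<omega>)) / tau l d) \<ge> \<alpha>"
        unfolding sum_level_densities[OF g] using \<open>d > 0\<close> by (simp add: field_simps)
      then have "ord_contains VF EF (cube d) lex_less (pull E' \<omega>)" using contains g by blast
      then have "ord_contains VF EF VH (<) E'"
        by (rule ord_contains_trans[where \<phi> = "\<phi> \<omega>"]) (use w \<phi> in \<open>auto simp: pull_def\<close>)
      then show False using E'(2) by blast
    qed
    then have "(\<Sum>\<omega>\<in>\<Omega>. \<Sum>e\<in>pull E' \<omega>. 1 / tau (pair_level e) d) \<le> (\<Sum>\<omega>\<in>\<Omega>. \<alpha> * real d)"
      by (rule sum_mono)
    then have "real (card E') * (2 / 2 ^ d) \<le> \<alpha> * (real (card EH) * (2 / 2 ^ d))"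
      unfolding count[OF E'(1)] total by (simp add: mult_ac)
    then have "real (card E') * (2 / 2 ^ d) \<le> (\<alpha> * real (card EH)) * (2 / 2 ^ d)"
      by (simp only: mult.assoc)
    then have "real (card E') \<le> \<alpha> * real (card EH)"
      by (rule mult_right_le_imp_le) simp
    then show "real (card E') / real (card EH) \<le> \<alpha>"
      using \<open>card EH > 0\<close> by (simp add: divide_le_eq)
  qed
  then show ?thesis using rho_le[OF H(1) \<open>card EH > 0\<close>, of VF EF] by linarith
qed

section \<open>The three thresholds\<close>

lemma lex_less_irrefl: "\<not> lex_less x x"
  by (simp add: lex_less_def)

lemma rho_nonneg: "rho VF EF \<ge> 0"
  and less_rho_witness: "rho VF EF < \<alpha> \<Longrightarrow> \<exists>VG EG. is_graph VG EG \<and> card EG > 0 \<and> rho_FG VF EF VG EG < \<alpha>"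
proof -
  let ?S = "{rho_FG VF EF VG EG | VG EG. is_graph VG EG \<and> card EG > 0}"
  \<comment> \<open>A single edge shows that the infimum runs over a nonempty set.\<close>
  have "is_graph {0, 1 :: nat} {{0, 1}} \<and> card {{0, 1 :: nat}} > 0"
    by (auto simp: is_graph_def)
  then have ne: "?S \<noteq> {}" by blast
  show "rho VF EF \<ge> 0"
    unfolding rho_def using ne by (rule cInf_greatest) (auto simp: rho_FG_nonneg)
  show "\<exists>VG EG. is_graph VG EG \<and> card EG > 0 \<and> rho_FG VF EF VG EG < \<alpha>" if "rho VF EF < \<alpha>"
    using cInf_lessD[OF ne that[unfolded rho_def]] by blast
qed

text \<open>Take \<open>G\<close> with relative density below \<open>\<alpha>\<close>. Some
  embedding sends more of its edges into \<open>E\<close> than an \<open>F\<close>-free subgraph of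
  \<open>G\<close> can have, so these edges contain \<open>F\<close>, and the embedding carries that
  copy into the cube.\<close>

lemma rho_less_imp_rich_contains:
  assumes "rho VF EF < \<alpha>"
  shows "\<exists>C. \<forall>d E. is_graph (cube d) E \<and> rich \<alpha> C d E \<longrightarrow> ord_contains VF EF (cube d) lex_less E"
proof -
  obtain VG EG where G: "is_graph VG EG" "card EG > 0" "rho_FG VF EF VG EG < \<alpha>"
    using less_rho_witness[OF assms] by blast
  \<comment> \<open>Half of the gap, so that \<open>\<alpha> - \<epsilon>\<close> still exceeds the
    relative density of \<open>G\<close>.\<close>
  define \<epsilon> where "\<epsilon> = (\<alpha> - rho_FG VF EF VG EG) / 2"
  have "\<epsilon> > 0" using G(3) by (simp add: \<epsilon>_def)
  then obtain C where C: "\<forall>\<alpha> d E. is_graph (cube d) E \<and> rich \<alpha> C d E \<longrightarrow>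
    (\<exists>\<phi>. \<phi> ` VG \<subseteq> cube d \<and> (\<forall>x\<in>VG. \<forall>y\<in>VG. x < y \<longrightarrow> lex_less (\<phi> x) (\<phi> y))
      \<and> real (card {e \<in> EG. \<phi> ` e \<in> E}) \<ge> (\<alpha> - \<epsilon>) * real (card EG))"
    using rich_average_embedding[OF G(1)] by blast
  show ?thesis
  proof (intro exI[of _ C] allI impI)
    fix d E assume "is_graph (cube d) E \<and> rich \<alpha> C d E"
    then obtain \<phi> where \<phi>: "\<phi> ` VG \<subseteq> cube d" "\<forall>x\<in>VG. \<forall>y\<in>VG. x < y \<longrightarrow> lex_less (\<phi> x) (\<phi> y)"
      "real (card {e \<in> EG. \<phi> ` e \<in> E}) \<ge> (\<alpha> - \<epsilon>) * real (card EG)"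
      using C by blast
    have "rho_FG VF EF VG EG * real (card EG) < (\<alpha> - \<epsilon>) * real (card EG)"
      using G(2,3) by (intro mult_strict_right_mono) (auto simp: \<epsilon>_def field_simps)
    also note \<phi>(3)
    finally have "ord_contains VF EF VG (<) {e \<in> EG. \<phi> ` e \<in> E}"
      by (intro rho_FG_less_contains[OF G(1)]) auto
    then show "ord_contains VF EF (cube d) lex_less E"
      by (rule ord_contains_trans[where \<phi> = \<phi>]) (use \<phi> lex_less_irrefl in auto)
  qed
qed

text \<open>With the error below \<open>1 / card EF\<close>, embedding \<open>F\<close> itself loses
  less than one edge, hence none. This makes 1 an admissible threshold, so the infimum is over a
  nonempty set.\<close>

lemma complete_rich_contains:
  assumes F: "is_graph VF EF"
  shows "\<exists>C. \<forall>d E. is_graph (cube d) E \<and> rich 1 C d E \<longrightarrow> ord_contains VF EF (cube d) lex_less E"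
proof -
  define \<epsilon> where "\<epsilon> = 1 / (real (card EF) + 1)"
  have "\<epsilon> > 0" by (simp add: \<epsilon>_def add_nonneg_pos)
  then obtain C where C: "\<forall>\<alpha> d E. is_graph (cube d) E \<and> rich \<alpha> C d E \<longrightarrow>
    (\<exists>\<phi>. \<phi> ` VF \<subseteq> cube d \<and> (\<forall>x\<in>VF. \<forall>y\<in>VF. x < y \<longrightarrow> lex_less (\<phi> x) (\<phi> y))
      \<and> real (card {e \<in> EF. \<phi> ` e \<in> E}) \<ge> (\<alpha> - \<epsilon>) * real (card EF))"
    using rich_average_embedding[OF F] by blast
  have finE: "finite EF" by (rule finite_edges[OF F])
  show ?thesis
  proof (intro exI[of _ C] allI impI)
    fix d E assume "is_graph (cube d) E \<and> rich 1 C d E"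
    then obtain \<phi> where \<phi>: "\<phi> ` VF \<subseteq> cube d" "\<forall>x\<in>VF. \<forall>y\<in>VF. x < y \<longrightarrow> lex_less (\<phi> x) (\<phi> y)"
      "real (card {e \<in> EF. \<phi> ` e \<in> E}) \<ge> (1 - \<epsilon>) * real (card EF)"
      using C by blast
    have "real (card EF) - 1 < (1 - \<epsilon>) * real (card EF)"
      by (simp add: \<epsilon>_def field_simps)
    then have "card EF \<le> card {e \<in> EF. \<phi> ` e \<in> E}" using \<phi>(3) by linarith
    then have all: "{e \<in> EF. \<phi> ` e \<in> E} = EF" by (intro card_seteq finE) auto
    have "ord_contains VF EF VF (<) EF"
      unfolding ord_contains_def by (rule exI[of _ id]) auto
    then show "ord_contains VF EF (cube d) lex_less E"
      by (rule ord_contains_trans[where \<phi> = \<phi>]) (use \<phi> all lex_less_irrefl in auto)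
  qed
qed

text \<open>Rich levels have density at most 1 and the others less than \<open>\<alpha>\<close>, so
  an average of \<open>\<beta>\<close> leaves at least \<open>(\<beta> - \<alpha>) * d\<close> rich
  levels. If both thresholds are 1, every level must be full.\<close>

lemma average_imp_rich:
  assumes \<alpha>: "0 \<le> \<alpha>" "\<alpha> < \<beta> \<or> \<alpha> = 1 \<and> \<beta> = 1"
  shows "\<exists>d\<^sub>0. \<forall>d\<ge>d\<^sub>0. \<forall>E. is_graph (cube d) E \<and>
    (1 / real d) * (\<Sum>l = 1..d. real (level_edges l E) / tau l d) \<ge> \<beta> \<longrightarrow> rich \<alpha> C d E"
proof -
  \<comment> \<open>The last entry ensures \<open>(\<beta> - \<alpha>) * d \<ge> C\<close>. For
    \<open>\<alpha> = \<beta> = 1\<close> the quotient is 0 by the convention for division, and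
    \<open>d \<ge> C\<close> takes over.\<close>
  define d\<^sub>0 where "d\<^sub>0 = max (max 1 C) (nat \<lceil>real C / (\<beta> - \<alpha>)\<rceil>)"
  show ?thesis
  proof (intro exI[of _ d\<^sub>0] allI impI)
    fix d E assume d: "d \<ge> d\<^sub>0" and "is_graph (cube d) E \<and>
      (1 / real d) * (\<Sum>l = 1..d. real (level_edges l E) / tau l d) \<ge> \<beta>"
    then have E: "is_graph (cube d) E"
      and avg: "(1 / real d) * (\<Sum>l = 1..d. real (level_edges l E) / tau l d) \<ge> \<beta>" by auto
    have "d > 0" "d \<ge> C" using d by (auto simp: d\<^sub>0_def)
    let ?q = "\<lambda>l. real (level_edges l E) / tau l d"
    let ?R = "{l \<in> {1..d}. real (level_edges l E) \<ge> \<alpha> * tau l d}"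
    have sum: "\<beta> * real d \<le> (\<Sum>l = 1..d. ?q l)" using avg \<open>d > 0\<close> by (simp add: field_simps)
    have q1: "?q l \<le> 1" if "l \<in> {1..d}" for l
      using level_edges_le_tau[OF E that] tau_pos[of l d] by simp
    have q2: "?q l < \<alpha>" if "l \<in> {1..d} - ?R" for l
      using that tau_pos[of l d] by (auto simp: divide_less_eq)
    have "C \<le> card ?R"
    proof (cases "\<alpha> < \<beta>")
      case True
      have "(\<Sum>l = 1..d. ?q l) = (\<Sum>l\<in>{1..d} - ?R. ?q l) + (\<Sum>l\<in>?R. ?q l)"
        by (rule sum.subset_diff) auto
      also have "\<dots> \<le> (\<Sum>l\<in>{1..d} - ?R. \<alpha>) + (\<Sum>l\<in>?R. 1)"
        using q1 q2 by (intro add_mono sum_mono) (auto intro: less_imp_le)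
      also have "\<dots> \<le> \<alpha> * real d + real (card ?R)"
      proof -
        have "card ({1..d} - ?R) \<le> card {1..d}" by (rule card_mono) auto
        then have "real (card ({1..d} - ?R)) * \<alpha> \<le> real d * \<alpha>"
          using \<alpha>(1) by (intro mult_right_mono) auto
        then show ?thesis by (simp add: mult.commute)
      qed
      finally have "(\<beta> - \<alpha>) * real d \<le> real (card ?R)" using sum by (simp add: algebra_simps)
      moreover have "real C / (\<beta> - \<alpha>) \<le> real d" using d by (simp add: d\<^sub>0_def)
      then have "real C \<le> (\<beta> - \<alpha>) * real d" using True by (simp add: field_simps)
      ultimately show ?thesis by linarith
    next
      case False
      then have ab: "\<alpha> = 1" "\<beta> = 1" using \<alpha>(2) by auto
      have "?R = {1..d}"
      proof (rule ccontr)
        assume "?R \<noteq> {1..d}"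
        then obtain l where l: "l \<in> {1..d} - ?R" by blast
        have "(\<Sum>l = 1..d. ?q l) < (\<Sum>l = 1..d. 1)"
          using q1 q2[OF l] l ab by (intro sum_strict_mono_ex1) auto
        then show False using sum ab by simp
      qed
      then show ?thesis using \<open>d \<ge> C\<close> by simp
    qed
    then show "rich \<alpha> C d E" by (simp add: rich_def)
  qed
qed

theorem theorem3p1:
  fixes VF :: "nat set" and EF :: "nat set set"
  assumes "is_graph VF EF"
  shows "rho VF EF =
           Inf {\<alpha> \<in> {0..1}. \<exists>d0. \<forall>d\<ge>d0. \<forall>E. is_graph (cube d) E \<and>
                  (1 / real d) * (\<Sum>l = 1..d. real (level_edges l E) / tau l d) \<ge> \<alpha>
                  \<longrightarrow> ord_contains VF EF (cube d) lex_less E} \<and>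
         rho VF EF =
           Inf {\<alpha> \<in> {0..1}. \<exists>C::nat. \<forall>d E. is_graph (cube d) E \<and> rich \<alpha> C d E
                  \<longrightarrow> ord_contains VF EF (cube d) lex_less E}"
proof -
  define A where "A = {\<alpha> \<in> {0..1}. \<exists>d0. \<forall>d\<ge>d0. \<forall>E. is_graph (cube d) E \<and>
                  (1 / real d) * (\<Sum>l = 1..d. real (level_edges l E) / tau l d) \<ge> \<alpha>
                  \<longrightarrow> ord_contains VF EF (cube d) lex_less E}"
  define R where "R = {\<alpha> \<in> {0..1}. \<exists>C::nat. \<forall>d E. is_graph (cube d) E \<and> rich \<alpha> C d E
                  \<longrightarrow> ord_contains VF EF (cube d) lex_less E}"
  have bdd: "bdd_below A" "bdd_below R" by (auto simp: A_def R_def intro!: bdd_belowI[of _ 0])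
  have oneR: "1 \<in> R" using complete_rich_contains[OF assms] by (simp add: R_def)
  \<comment> \<open>The second alternative is there to put 1 into \<open>A\<close>: inside
    \<open>{0..1}\<close> no \<open>\<beta>\<close> lies strictly above
    \<open>\<alpha> = 1\<close>.\<close>
  have RA: "\<beta> \<in> A" if mem: "\<alpha> \<in> R" and less: "\<alpha> < \<beta> \<or> \<alpha> = 1 \<and> \<beta> = 1" and "\<beta> \<le> 1" for \<alpha> \<beta>
  proof -
    have "0 \<le> \<alpha>" using mem by (simp add: R_def)
    obtain C where C: "\<forall>d E. is_graph (cube d) E \<and> rich \<alpha> C d E
        \<longrightarrow> ord_contains VF EF (cube d) lex_less E"
      using mem unfolding R_def by blast
    obtain d\<^sub>0 where "\<forall>d\<ge>d\<^sub>0. \<forall>E. is_graph (cube d) E \<and>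
      (1 / real d) * (\<Sum>l = 1..d. real (level_edges l E) / tau l d) \<ge> \<beta> \<longrightarrow> rich \<alpha> C d E"
      using average_imp_rich[OF \<open>0 \<le> \<alpha>\<close> less, of C] by blast
    then have "\<exists>d0. \<forall>d\<ge>d0. \<forall>E. is_graph (cube d) E \<and>
        (1 / real d) * (\<Sum>l = 1..d. real (level_edges l E) / tau l d) \<ge> \<beta>
        \<longrightarrow> ord_contains VF EF (cube d) lex_less E"
      using C by blast
    moreover have "\<beta> \<in> {0..1}" using less \<open>\<beta> \<le> 1\<close> \<open>0 \<le> \<alpha>\<close> by auto
    ultimately show ?thesis by (simp add: A_def)
  qed
  have oneA: "1 \<in> A" using RA[OF oneR] by simp
  have "Inf R \<le> rho VF EF"
  proof (rule dense_ge)
    fix x assume x: "rho VF EF < x"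
    show "Inf R \<le> x"
    \<comment> \<open>Thresholds are confined to \<open>{0..1}\<close>; for \<open>x\<close> above 1
      the membership of 1 in \<open>R\<close> gives the bound.\<close>
    proof (cases "x \<le> 1")
      case True
      then have "x \<in> R"
        using rho_less_imp_rich_contains[OF x] rho_nonneg[of VF EF] x by (simp add: R_def)
      then show ?thesis using bdd by (intro cInf_lower)
    next
      case False
      then show ?thesis using cInf_lower[OF oneR bdd(2)] by simp
    qed
  qed
  moreover have "rho VF EF \<le> Inf A"
  proof (rule cInf_greatest)
    show "A \<noteq> {}" using oneA by blast
    fix \<alpha> assume \<alpha>: "\<alpha> \<in> A"
    then have "0 \<le> \<alpha>" by (simp add: A_def)
    obtain d0 where d0: "\<forall>d\<ge>d0. \<forall>E. is_graph (cube d) E \<and>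
        (1 / real d) * (\<Sum>l = 1..d. real (level_edges l E) / tau l d) \<ge> \<alpha>
        \<longrightarrow> ord_contains VF EF (cube d) lex_less E"
      using \<alpha> unfolding A_def by blast
    \<comment> \<open>A single positive dimension beyond \<open>d0\<close> suffices, whence
      \<open>max d0 1\<close>.\<close>
    show "rho VF EF \<le> \<alpha>"
      by (rule rho_le_average_threshold[of "max d0 1"]) (use d0 \<open>0 \<le> \<alpha>\<close> in simp_all)
  qed
  moreover have "Inf A \<le> Inf R"
  proof (rule cInf_greatest)
    show "R \<noteq> {}" using oneR by blast
    fix \<alpha> assume \<alpha>: "\<alpha> \<in> R"
    show "Inf A \<le> \<alpha>"
    proof (rule dense_ge)
      fix x assume x: "\<alpha> < x"
      show "Inf A \<le> x"
      proof (cases "x \<le> 1")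
        case True
        then show ?thesis using RA[OF \<alpha>] x bdd by (intro cInf_lower) auto
      next
        case False
        then show ?thesis using cInf_lower[OF oneA bdd(1)] by simp
      qed
    qed
  qed
  ultimately have "rho VF EF = Inf A \<and> rho VF EF = Inf R" by linarith
  then show ?thesis unfolding A_def R_def .
qed

end
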